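(* Let $\alpha\neq 0$, $\beta$, $\gamma$ be real numbers and let $\varepsilon>0$. There exists a constant $C>0$, depending only on $\alpha,\beta,\gamma$ and $\varepsilon$, such that for all real numbers $a>1$, $b>1$ and $\delta\in(0,1/2)$ the quantity $E_{\mathcal P}(a,b,\delta)$ defined by $$ A_{\mathcal P}(a,b,\delta)=2\delta b+E_{\mathcal P}(a,b,\delta) $$ satisfies $$ \left|E_{\mathcal P}(a,b,\delta)\right|\le C\left(a^{\frac12}+b\,a^{-\frac12}\right)\exp\left(\frac{\left(\frac12\ln 2+\varepsilon\right)\log\Delta}{\log\log\Delta}\right), \qquad \Delta=\max\left(\frac{b^2a^{\frac12}}{a+b},\,3\right). $$
   Context: $\mathcal P$ denotes the parabola $y=\alpha x^2+\beta x+\gamma$. For real $t$, $\|t\|=\min_{n\in\mathbb Z}|t-n|$ is the distance from $t$ to a nearest integer. The counting function is $$ A_{\mathcal P}(a,b,\delta)=\#\left\{x\in\mathbb Z:\ 1\le x\le b,\ \left\|\frac{\alpha x^2}{a}+\beta x+\gamma a\right\|<\delta\right\}. $$ Both $\log$ and $\ln$ denote the natural logarithm, and $\exp(x)=e^x$. *)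

theory Defs
  imports "HOL-Analysis.Analysis"
begin

definition dist_nearest_int :: "real \<Rightarrow> real" where
  "dist_nearest_int t = infdist t \<int>"

text \<open>The infimum in \<^const>\<open>infdist\<close> is attained, so this is the minimum of
  \<open>\<bar>t - n\<bar>\<close> over the integers \<open>n\<close>.\<close>

lemma dist_nearest_int_eq_round: "dist_nearest_int t = \<bar>t - of_int (round t)\<bar>"
proof (rule antisym)
  show "dist_nearest_int t \<le> \<bar>t - of_int (round t)\<bar>"
    unfolding dist_nearest_int_def using infdist_le[of "of_int (round t)" \<int> t]
    by (simp add: dist_real_def)
  have ne: "(\<int> :: real set) \<noteq> {}" using Ints_0 by blast
  show "\<bar>t - of_int (round t)\<bar> \<le> dist_nearest_int t"
    unfolding dist_nearest_int_def infdist_notempty[OF ne]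
    by (rule cINF_greatest[OF ne])
       (auto elim!: Ints_cases simp: dist_real_def round_diff_minimal)
qed

lemma dist_nearest_int_le: "dist_nearest_int t \<le> \<bar>t - of_int n\<bar>"
  by (simp add: dist_nearest_int_eq_round round_diff_minimal)

text \<open>The parabola \<open>y = \<alpha> x\<^sup>2 + \<beta> x + \<gamma>\<close> is represented by its coefficients.\<close>

definition near_points :: "real \<Rightarrow> real \<Rightarrow> real \<Rightarrow> real \<Rightarrow> real \<Rightarrow> real \<Rightarrow> int set" where
  "near_points \<alpha> \<beta> \<gamma> a b \<delta> =
     {x::int. 1 \<le> x \<and> real_of_int x \<le> b \<and>
        dist_nearest_int (\<alpha> * (real_of_int x)\<^sup>2 / a + \<beta> * real_of_int x + \<gamma> * a) < \<delta>}"

lemma finite_near_points: "finite (near_points \<alpha> \<beta> \<gamma> a b \<delta>)"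
  by (rule finite_subset[of _ "{1..\<lfloor>b\<rfloor>}"]) (auto simp: near_points_def le_floor_iff)

definition A_count :: "real \<Rightarrow> real \<Rightarrow> real \<Rightarrow> real \<Rightarrow> real \<Rightarrow> real \<Rightarrow> nat" where
  "A_count \<alpha> \<beta> \<gamma> a b \<delta> = card (near_points \<alpha> \<beta> \<gamma> a b \<delta>)"

definition E_error :: "real \<Rightarrow> real \<Rightarrow> real \<Rightarrow> real \<Rightarrow> real \<Rightarrow> real \<Rightarrow> real" where
  "E_error \<alpha> \<beta> \<gamma> a b \<delta> = real (A_count \<alpha> \<beta> \<gamma> a b \<delta>) - 2 * \<delta> * b"

definition Delta :: "real \<Rightarrow> real \<Rightarrow> real" where
  "Delta a b = max (b\<^sup>2 * a powr (1/2) / (a + b)) 3"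

end

theory Submission
  imports Defs "HOL-Computational_Algebra.Primes" "HOL-Real_Asymp.Real_Asymp"
begin

text \<open>
  Write \<open>e(t)\<close> for \<open>exp (2 \<pi> i t)\<close>, \<open>f x\<close> for the quadratic polynomial with leading coefficient \<open>\<alpha>/a\<close> whose
  values are to be close to integers, and \<open>W = \<surd>a + b / \<surd>a\<close>.  The number of \<open>x \<le> b\<close> with
  \<open>\<parallel>f x\<parallel> < \<delta>\<close> has the expected size \<open>2 \<delta> b\<close> if the values \<open>f x\<close> are equidistributed modulo \<open>1\<close>, and this
  is measured by the exponential sums \<open>S m = \<Sum>x. e(m f x)\<close>.

  An inequality of Erdos and Turan (\<open>erdos_turan_count\<close>) bounds the error by a logarithm times
  \<open>b/K + \<Sum>m<K. \<bar>S m\<bar>/m\<close>, for every \<open>K \<ge> 1\<close>.  It is obtained from the translates of a Fejer kernel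
  by the multiples of \<open>1/K\<close>, which form a partition of unity of the circle into nonnegative trigonometric
  polynomials: the translates centred in the interval sum to a function close to its indicator
  function.  This costs a logarithm compared with the sharp inequality, which is harmless here.

  The mean value of \<open>\<bar>S m\<bar>\<close> is estimated by the Cauchy-Schwarz inequality from that of \<open>\<bar>S m\<bar>\<^sup>2\<close>.
  Weyl differencing (\<open>weyl_differencing\<close>) bounds \<open>\<bar>S m\<bar>\<^sup>2\<close> by the sum over shifts \<open>h < b\<close> of geometric
  series with ratio \<open>e(2 m h \<alpha>/a)\<close>, of size about \<open>min b (1 / \<parallel>2 m h \<alpha>/a\<parallel>)\<close>.  Only the product
  \<open>n = m h < K b\<close> matters, and it arises from at most as many pairs as \<open>n\<close> has divisors
  (\<open>weighted_weyl_mean_square\<close>).  The points \<open>2 n \<alpha>/a\<close> are spaced by about \<open>1/a\<close>, so a block of \<open>b\<close>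
  consecutive values of \<open>n\<close> contributes \<open>(b/a + 1) (a + b) = W\<^sup>2\<close>, up to a logarithm
  (\<open>recip_cap_block_sum\<close>).  Taking the square root gives \<open>W\<close> times logarithms times the square root of
  the largest value of the divisor function below \<open>K b\<close>.

  The choice \<open>K = b \<surd>a / (a + b)\<close> makes \<open>b/K\<close> equal to \<open>W\<close> and \<open>K b\<close> equal to \<open>b\<^sup>2 \<surd>a / (a + b)\<close>, which
  explains the definition of \<open>\<Delta>\<close>.  The divisor function is at most
  \<open>exp ((ln 2 + o(1)) ln \<Delta> / ln (ln \<Delta>))\<close> up to \<open>\<Delta>\<close> (\<open>divisor_bound\<close>); its square root accounts for the
  constant \<open>(ln 2)/2\<close>, and \<open>\<epsilon>\<close> absorbs all powers of \<open>ln \<Delta>\<close>.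
\<close>

section \<open>Distance to the nearest integer and additive characters\<close>

lemma dist_nearest_int_nonneg: "0 \<le> dist_nearest_int t"
  by (simp add: dist_nearest_int_eq_round)

lemma dist_nearest_int_le_half: "dist_nearest_int t \<le> 1/2"
  using of_int_round_abs_le[of t] by (simp add: dist_nearest_int_eq_round abs_minus_commute)

lemma dist_nearest_int_le_abs: "dist_nearest_int t \<le> \<bar>t\<bar>"
  using dist_nearest_int_le[of t 0] by simp

lemma dist_nearest_int_minus: "dist_nearest_int (- t) = dist_nearest_int t"
proof -
  have "dist_nearest_int (- t) \<le> dist_nearest_int t" for t
    using dist_nearest_int_le[of "- t" "- round t"]
    by (simp add: dist_nearest_int_eq_round[of t])
  from this[of t] this[of "- t"] show ?thesis by simp
qed

lemma dist_nearest_int_triangle: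
  "dist_nearest_int (s + t) \<le> dist_nearest_int s + dist_nearest_int t"
  using dist_nearest_int_le[of "s + t" "round s + round t"]
  by (simp add: dist_nearest_int_eq_round[of s] dist_nearest_int_eq_round[of t])

lemma dist_nearest_int_obtain:
  obtains q :: int where "t = of_int q + dist_nearest_int t \<or> t = of_int q - dist_nearest_int t"
proof
  show "t = of_int (round t) + dist_nearest_int t \<or> t = of_int (round t) - dist_nearest_int t"
    by (auto simp: dist_nearest_int_eq_round abs_if)
qed

lemma dist_nearest_int_geI:
  assumes "of_int p + c \<le> t" "t \<le> of_int p + 1 - c"
  shows "c \<le> dist_nearest_int t"
proof -
  consider "round t \<le> p" | "round t \<ge> p + 1" by linarith
  then have "real_of_int (round t) \<le> of_int p \<or> real_of_int (round t) \<ge> of_int p + 1"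
    by cases (auto simp flip: of_int_add)
  then show ?thesis using assms by (auto simp: dist_nearest_int_eq_round)
qed

definition expi2pi :: "real \<Rightarrow> complex" where
  "expi2pi t = cis (2 * pi * t)"

lemma expi2pi_0: "expi2pi 0 = 1"
  by (simp add: expi2pi_def)

lemma expi2pi_add: "expi2pi (s + t) = expi2pi s * expi2pi t"
  by (simp add: expi2pi_def cis_mult distrib_left)

lemma expi2pi_of_int: "expi2pi (of_int n) = 1"
  by (simp add: expi2pi_def)

lemma norm_expi2pi: "norm (expi2pi t) = 1"
  by (simp add: expi2pi_def)

lemma cnj_expi2pi: "cnj (expi2pi t) = expi2pi (- t)"
  by (simp add: expi2pi_def cis_cnj)

lemma expi2pi_mult_nat: "expi2pi (real n * t) = expi2pi t ^ n"
  unfolding expi2pi_def Complex.DeMoivre by (rule arg_cong[of _ _ cis]) simp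

lemma expi2pi_add_int: "expi2pi (t + of_int n) = expi2pi t"
  by (simp add: expi2pi_add expi2pi_of_int)

text \<open>Concavity of the sine puts its graph above the chord on \<open>[0, \<pi>/2]\<close>.\<close>

lemma sin_ge_chord:
  fixes x :: real
  assumes "0 \<le> x" "x \<le> pi / 2"
  shows "2 / pi * x \<le> sin x"
proof -
  have "convex_on {0..pi/2} (\<lambda>x. - sin x :: real)"
    by (rule f''_ge0_imp_convex[where f' = "\<lambda>x. - cos x" and f'' = "\<lambda>x. sin x"])
       (auto intro!: derivative_eq_intros sin_ge_zero)
  from convex_onD[OF this, of "2 / pi * x" 0 "pi/2"] assms
  show ?thesis by (simp add: field_simps)
qed

text \<open>The chord from \<open>1\<close> to \<open>exp (2 \<pi> i t)\<close> has length \<open>2 \<bar>sin (\<pi>t)\<bar>\<close>.\<close>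

lemma norm_one_minus_expi2pi_ge: "4 * dist_nearest_int t \<le> norm (1 - expi2pi t)"
proof -
  define d where "d = dist_nearest_int t"
  obtain q where q: "t = of_int q + d \<or> t = of_int q - d"
    unfolding d_def by (rule dist_nearest_int_obtain)
  have d: "0 \<le> d" "d \<le> 1/2"
    unfolding d_def by (rule dist_nearest_int_nonneg dist_nearest_int_le_half)+
  have "expi2pi t = expi2pi d \<or> expi2pi t = cnj (expi2pi d)"
    using q expi2pi_add_int[of d q] expi2pi_add_int[of "- d" q] by (auto simp: cnj_expi2pi add.commute)
  then have "norm (1 - expi2pi t) = norm (1 - expi2pi d)"
    using complex_mod_cnj[of "1 - expi2pi d"] by auto
  moreover have "(norm (1 - expi2pi d))\<^sup>2 = (2 * sin (pi * d))\<^sup>2"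
  proof -
    have "(norm (1 - expi2pi d))\<^sup>2 = (1 - cos (2 * (pi * d)))\<^sup>2 + (sin (2 * (pi * d)))\<^sup>2"
      by (simp add: expi2pi_def cmod_power2 mult.assoc)
    also have "\<dots> = 2 - 2 * cos (2 * (pi * d))"
      unfolding power2_diff sin_squared_eq by simp
    also have "\<dots> = (2 * sin (pi * d))\<^sup>2"
      unfolding cos_double_sin by (simp add: power_mult_distrib)
    finally show ?thesis .
  qed
  moreover have "2 / pi * (pi * d) \<le> sin (pi * d)"
    using d by (intro sin_ge_chord) auto
  then have "2 * d \<le> sin (pi * d)" by simp
  ultimately have "(norm (1 - expi2pi t))\<^sup>2 = (2 * sin (pi * d))\<^sup>2" "0 \<le> 2 * sin (pi * d)"
    using d by auto
  then have eq: "norm (1 - expi2pi t) = 2 * sin (pi * d)"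
    by (rule power2_eq_imp_eq[OF _ norm_ge_zero])
  show ?thesis
    unfolding eq using \<open>2 * d \<le> sin (pi * d)\<close> by (simp only: d_def[symmetric])
qed

text \<open>A geometric series.  The inequality is written without a quotient so that it also covers
  integral \<open>t\<close>.\<close>

lemma norm_sum_expi2pi_progression_le:
  "2 * dist_nearest_int t * norm (\<Sum>k<n. expi2pi (real k * t + c)) \<le> 1"
proof -
  have "(\<Sum>k<n. expi2pi (real k * t + c)) = expi2pi c * (\<Sum>k<n. expi2pi t ^ k)"
    by (simp add: expi2pi_add expi2pi_mult_nat sum_distrib_left mult.commute[of "expi2pi c"])
  then have "norm (1 - expi2pi t) * norm (\<Sum>k<n. expi2pi (real k * t + c))
      = norm ((1 - expi2pi t) * (\<Sum>k<n. expi2pi t ^ k))"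
    by (simp add: norm_mult norm_expi2pi)
  also have "\<dots> = norm (1 - expi2pi t ^ n)"
    by (simp add: one_diff_power_eq)
  also have "\<dots> \<le> 2"
    using norm_triangle_ineq4[of 1 "expi2pi t ^ n"] by (simp add: norm_power norm_expi2pi)
  finally have "norm (1 - expi2pi t) * norm (\<Sum>k<n. expi2pi (real k * t + c)) \<le> 2" .
  moreover have "4 * dist_nearest_int t * norm (\<Sum>k<n. expi2pi (real k * t + c))
      \<le> norm (1 - expi2pi t) * norm (\<Sum>k<n. expi2pi (real k * t + c))"
    by (intro mult_right_mono norm_one_minus_expi2pi_ge) auto
  ultimately show ?thesis by simp
qed

lemma norm_sum_expi2pi_le: "norm (\<Sum>k<n. expi2pi (g k)) \<le> real n"
  using sum_norm_le[of "{..<n}" "\<lambda>k. expi2pi (g k)" "\<lambda>_. 1"] by (simp add: norm_expi2pi)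

section \<open>Elementary summation tools\<close>

text \<open>A majorant that depends only on an index \<open>\<kappa> x\<close> may be summed over the values of the index, at
  the price of their multiplicity.  Well-spaced points, arcs of the circle and divisors all enter
  through this inequality: the multiplicities are \<open>2\<close>, a count of points in short arcs, and the
  divisor function.\<close>

lemma sum_le_fibre_sum:
  fixes u :: "'a \<Rightarrow> real" and w :: "'b \<Rightarrow> real"
  assumes "finite X" "finite T"
    and "\<And>x. x \<in> X \<Longrightarrow> \<kappa> x \<in> T"
    and "\<And>x. x \<in> X \<Longrightarrow> u x \<le> w (\<kappa> x)"
    and "\<And>k. k \<in> T \<Longrightarrow> 0 \<le> w k"
    and "\<And>k. k \<in> T \<Longrightarrow> real (card {x \<in> X. \<kappa> x = k}) \<le> c"
  shows "sum u X \<le> c * sum w T"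
proof -
  have "sum u X \<le> (\<Sum>x\<in>X. w (\<kappa> x))"
    using assms by (intro sum_mono) auto
  also have "\<dots> = (\<Sum>k\<in>T. \<Sum>x\<in>{x\<in>X. \<kappa> x = k}. w (\<kappa> x))"
    using assms by (intro sum.group[symmetric]) auto
  also have "\<dots> = (\<Sum>k\<in>T. real (card {x\<in>X. \<kappa> x = k}) * w k)"
    by (intro sum.cong) auto
  also have "\<dots> \<le> (\<Sum>k\<in>T. c * w k)"
    using assms by (intro sum_mono mult_right_mono) auto
  finally show ?thesis by (simp add: sum_distrib_left)
qed

text \<open>Only two integers lie at a distance with a prescribed integer part from a given real number:
  one on each side of it.\<close>

lemma integers_at_distance_subset:
  fixes v :: real
  shows "{n::int. \<lfloor>\<bar>v - of_int n\<bar>\<rfloor> = k} \<subseteq> {\<lfloor>v\<rfloor> - k, \<lceil>v\<rceil> + k}"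
  by (auto simp: abs_if split: if_splits) linarith+

lemma finite_integers_at_distance:
  fixes v :: real
  shows "finite {n::int. \<lfloor>\<bar>v - of_int n\<bar>\<rfloor> = k}"
  by (rule finite_subset[OF integers_at_distance_subset]) auto

lemma card_integers_at_distance_le:
  fixes v :: real
  shows "card {n::int. \<lfloor>\<bar>v - of_int n\<bar>\<rfloor> = k} \<le> 2"
proof -
  have "card {n::int. \<lfloor>\<bar>v - of_int n\<bar>\<rfloor> = k} \<le> card {\<lfloor>v\<rfloor> - k, \<lceil>v\<rceil> + k}"
    by (intro card_mono integers_at_distance_subset) auto
  also have "\<dots> \<le> 2" by (simp add: card_insert_if)
  finally show ?thesis .
qed

lemma harm_le_ln:
  assumes "n > 0" shows "harm n \<le> 1 + ln (real n)"
  using assms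
proof (induction n rule: nat_induct_non_zero)
  case 1 then show ?case by (simp add: harm_expand)
next
  case (Suc n)
  have "ln (1 - 1 / real (Suc n)) \<le> - (1 / real (Suc n))"
    using ln_add_one_self_le_self2[of "- (1 / real (Suc n))"] Suc by (simp add: field_simps)
  moreover have "1 - 1 / real (Suc n) = real n / real (Suc n)"
    by (simp add: field_simps)
  ultimately have "inverse (real (Suc n)) \<le> ln (real (Suc n)) - ln (real n)"
    using Suc by (simp add: ln_div inverse_eq_divide)
  then show ?case using Suc by (simp add: harm_Suc)
qed

lemma sum_inverse_Suc_eq_harm: "(\<Sum>k<n. 1 / (1 + real k)) = harm n"
  by (simp add: harm_altdef inverse_eq_divide add.commute)

text \<open>Expanding the square of an exponential sum produces terms that depend only on the difference of
  two indices, and the difference \<open>\<plusminus>l\<close> occurs \<open>K - l\<close> times.\<close>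

lemma sum_square_by_difference:
  fixes h :: "int \<Rightarrow> 'a::comm_ring_1"
  shows "(\<Sum>m<K. \<Sum>n<K. h (int m - int n))
    = of_nat K * h 0 + (\<Sum>l=1..<K. of_nat (K - l) * (h (int l) + h (- int l)))"
proof (induction K)
  case 0 then show ?case by simp
next
  case (Suc K)
  have A: "(\<Sum>m<Suc K. \<Sum>n<Suc K. h (int m - int n))
    = (\<Sum>m<K. \<Sum>n<K. h (int m - int n)) + (\<Sum>m<K. h (int m - int K))
      + (\<Sum>n<K. h (int K - int n)) + h 0"
    by (simp add: sum.distrib algebra_simps)
  have "(\<Sum>m<K. h (int m - int K)) = (\<Sum>l\<in>{1..<Suc K}. h (- int l))"
    by (rule sum.reindex_bij_witness[of _ "\<lambda>l. K - l" "\<lambda>m. K - m"]) (auto simp: of_nat_diff)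
  moreover have "(\<Sum>n<K. h (int K - int n)) = (\<Sum>l\<in>{1..<Suc K}. h (int l))"
    by (rule sum.reindex_bij_witness[of _ "\<lambda>l. K - l" "\<lambda>m. K - m"]) (auto simp: of_nat_diff)
  moreover have "(\<Sum>l=1..<Suc K. of_nat (Suc K - l) * (h (int l) + h (- int l)))
     = (\<Sum>l=1..<Suc K. of_nat (K - l) * (h (int l) + h (- int l))) +
       (\<Sum>l=1..<Suc K. h (int l) + h (- int l))"
    unfolding sum.distrib[symmetric]
    by (intro sum.cong) (auto simp: Suc_diff_le algebra_simps)
  moreover have "(\<Sum>l=1..<Suc K. of_nat (K - l) * (h (int l) + h (- int l)))
      = (\<Sum>l=1..<K. of_nat (K - l) * (h (int l) + h (- int l)))"
    by (cases K) auto
  ultimately show ?case unfolding A Suc.IH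
    by (simp add: sum.distrib algebra_simps)
qed

section \<open>The discrete Fejer partition of unity\<close>

text \<open>The Fejer kernel of order \<open>K\<close>, divided by \<open>K\<close>.  With this scaling its values lie between \<open>0\<close>
  and \<open>1\<close>, and its translates by the multiples of \<open>1/K\<close> add up to \<open>1\<close>.  A sum of such translates over
  grid points is a smooth substitute for the indicator function of an interval, and since the grid is
  finite no integral is needed to compute its Fourier coefficients.\<close>

definition fejer :: "nat \<Rightarrow> real \<Rightarrow> real" where
  "fejer K t = (norm (\<Sum>m<K. expi2pi (real m * t)))\<^sup>2 / (real K)\<^sup>2"

lemma fejer_nonneg: "0 \<le> fejer K t"
  by (simp add: fejer_def)

lemma fejer_decay:
  assumes "K > 0"
  shows "4 * (real K * dist_nearest_int t)\<^sup>2 * fejer K t \<le> 1"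
proof -
  let ?s = "norm (\<Sum>m<K. expi2pi (real m * t))"
  have "2 * dist_nearest_int t * ?s \<le> 1"
    using norm_sum_expi2pi_progression_le[of t 0 K] by (simp only: add_0_right)
  then have "(2 * dist_nearest_int t * ?s)\<^sup>2 \<le> 1"
    by (intro power_le_one mult_nonneg_nonneg) (auto simp: dist_nearest_int_nonneg)
  then show ?thesis
    using assms by (simp add: fejer_def power_mult_distrib)
qed

text \<open>Close to an integer all \<open>K\<close> summands of the kernel point into the sector of half-angle \<open>\<pi>/3\<close>
  around the positive axis, so that their real parts are at least \<open>1/2\<close>.\<close>

lemma fejer_ge_quarter:
  assumes K: "K > 0" and t: "dist_nearest_int t \<le> 1 / (6 * real K)"
  shows "1/4 \<le> fejer K t"
proof -
  define d where "d = dist_nearest_int t"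
  have d0: "0 \<le> d" unfolding d_def by (rule dist_nearest_int_nonneg)
  obtain q where q: "t = of_int q + d \<or> t = of_int q - d"
    unfolding d_def by (rule dist_nearest_int_obtain)
  have "1/2 \<le> Re (expi2pi (real m * t))" if "m < K" for m
  proof -
    have "expi2pi (real m * t) = expi2pi (real m * d) \<or> expi2pi (real m * t) = expi2pi (- (real m * d))"
    proof -
      have "real m * t = real m * d + of_int (int m * q) \<or> real m * t = - (real m * d) + of_int (int m * q)"
        using q by (auto simp add: distrib_left right_diff_distrib)
      then show ?thesis by (metis expi2pi_add_int)
    qed
    then have "Re (expi2pi (real m * t)) = cos (2 * pi * (real m * d))"
      by (elim disjE) (simp_all add: expi2pi_def)
    moreover have "real m * d \<le> real K * (1 / (6 * real K))"
      using that t d0 by (intro mult_mono) (auto simp: d_def)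
    then have "real m * d \<le> 1/6" using K by simp
    then have "cos (pi / 3) \<le> cos (2 * pi * (real m * d))"
      using d0 by (subst cos_mono_le_eq) (auto simp: mult_le_one)
    ultimately show ?thesis by (simp add: cos_60)
  qed
  then have "(\<Sum>m<K. 1/2) \<le> (\<Sum>m<K. Re (expi2pi (real m * t)))"
    by (intro sum_mono) auto
  then have "real K / 2 \<le> Re (\<Sum>m<K. expi2pi (real m * t))" by simp
  also have "\<dots> \<le> norm (\<Sum>m<K. expi2pi (real m * t))" by (rule complex_Re_le_cmod)
  finally have "(real K / 2)\<^sup>2 \<le> (norm (\<Sum>m<K. expi2pi (real m * t)))\<^sup>2"
    by (intro power_mono) auto
  then show ?thesis using K by (simp add: fejer_def field_simps power2_eq_square)
qed

lemma fejer_expand: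
  "complex_of_real (fejer K t)
    = (\<Sum>m<K. \<Sum>n<K. expi2pi (of_int (int m - int n) * t)) / (of_nat K)\<^sup>2"
proof -
  have "complex_of_real ((norm (\<Sum>m<K. expi2pi (real m * t)))\<^sup>2)
     = (\<Sum>m<K. expi2pi (real m * t)) * (\<Sum>n<K. expi2pi (- (real n * t)))"
    by (simp only: complex_norm_square cnj_sum cnj_expi2pi)
  also have "\<dots> = (\<Sum>m<K. \<Sum>n<K. expi2pi (of_int (int m - int n) * t))"
    unfolding sum_product by (simp add: expi2pi_add[symmetric] algebra_simps)
  finally show ?thesis by (simp add: fejer_def)
qed

lemma sum_expi2pi_residues:
  assumes "0 < l" "l < K"
  shows "(\<Sum>j<K. expi2pi (real j * (real l / real K))) = 0"
proof -
  let ?z = "expi2pi (real l / real K)"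
  have "0 < min (real l / real K) (1 - real l / real K)"
    using assms by auto
  also have "\<dots> \<le> dist_nearest_int (real l / real K)"
    by (rule dist_nearest_int_geI[of 0]) auto
  finally have "1 - ?z \<noteq> 0"
    using norm_one_minus_expi2pi_ge[of "real l / real K"] by auto
  moreover have "?z ^ K = 1"
    using expi2pi_of_int[of "int l"] assms by (simp flip: expi2pi_mult_nat)
  then have "(1 - ?z) * (\<Sum>j<K. ?z ^ j) = 0"
    by (simp flip: one_diff_power_eq)
  ultimately have "(\<Sum>j<K. ?z ^ j) = 0" by simp
  then show ?thesis by (simp only: expi2pi_mult_nat)
qed

definition exp_sum :: "(nat \<Rightarrow> real) \<Rightarrow> nat \<Rightarrow> int \<Rightarrow> complex" where
  "exp_sum f B l = (\<Sum>x<B. expi2pi (of_int l * f x))"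

lemma norm_exp_sum_minus: "norm (exp_sum f B (- l)) = norm (exp_sum f B l)"
proof -
  have "exp_sum f B (- l) = cnj (exp_sum f B l)"
    by (simp add: exp_sum_def cnj_expi2pi)
  then show ?thesis by simp
qed

lemma exp_sum_0: "exp_sum f B 0 = of_nat B"
  by (simp add: exp_sum_def expi2pi_0)

text \<open>The Fourier expansion of a sum of kernels over all differences \<open>f x - s j\<close>: the frequency \<open>0\<close>
  gives the main term, and each other frequency splits into an exponential sum over the points \<open>f x\<close>
  and one over the shifts \<open>s j\<close>.\<close>

lemma fejer_double_sum:
  "complex_of_real (\<Sum>x<B. \<Sum>j<N. fejer K (f x - s j))
     = (of_nat K * of_nat B * of_nat N
        + (\<Sum>l=1..<K. of_nat (K - l) * (exp_sum f B (int l) * exp_sum (\<lambda>j. - s j) N (int l)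
              + exp_sum f B (- int l) * exp_sum (\<lambda>j. - s j) N (- int l)))) / (of_nat K)\<^sup>2"
proof -
  define h where "h l = exp_sum f B l * exp_sum (\<lambda>j. - s j) N l" for l
  have h: "h l = (\<Sum>x<B. \<Sum>j<N. expi2pi (of_int l * (f x - s j)))" for l
    unfolding h_def exp_sum_def sum_product
    by (simp add: expi2pi_add[symmetric] algebra_simps)
  have swap: "(\<Sum>x<B. \<Sum>j<N. \<Sum>m<K. G x j m) = (\<Sum>m<K. \<Sum>x<B. \<Sum>j<N. G x j m)"
    for G :: "nat \<Rightarrow> nat \<Rightarrow> nat \<Rightarrow> complex"
  proof -
    have "(\<Sum>j<N. \<Sum>m<K. G x j m) = (\<Sum>m<K. \<Sum>j<N. G x j m)" for x
      by (rule sum.swap)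
    then have "(\<Sum>x<B. \<Sum>j<N. \<Sum>m<K. G x j m) = (\<Sum>x<B. \<Sum>m<K. \<Sum>j<N. G x j m)"
      by simp
    also have "\<dots> = (\<Sum>m<K. \<Sum>x<B. \<Sum>j<N. G x j m)"
      by (rule sum.swap)
    finally show ?thesis .
  qed
  have "complex_of_real (\<Sum>x<B. \<Sum>j<N. fejer K (f x - s j))
     = (\<Sum>x<B. \<Sum>j<N. \<Sum>m<K. \<Sum>n<K. expi2pi (of_int (int m - int n) * (f x - s j))) / (of_nat K)\<^sup>2"
    by (simp only: of_real_sum fejer_expand sum_divide_distrib)
  also have "(\<Sum>x<B. \<Sum>j<N. \<Sum>m<K. \<Sum>n<K. expi2pi (of_int (int m - int n) * (f x - s j)))
     = (\<Sum>m<K. \<Sum>n<K. h (int m - int n))"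
    unfolding h by (simp only: swap)
  also have "\<dots> = of_nat K * h 0 + (\<Sum>l=1..<K. of_nat (K - l) * (h (int l) + h (- int l)))"
    by (rule sum_square_by_difference)
  finally show ?thesis by (simp add: h_def exp_sum_0)
qed

text \<open>All frequencies \<open>0 < \<bar>l\<bar> < K\<close> of the kernel cancel on the grid of the multiples of \<open>1/K\<close>.\<close>

lemma fejer_partition_of_unity:
  assumes K: "K > 0"
  shows "(\<Sum>j<K. fejer K (t - real j / real K)) = 1"
proof -
  let ?s = "\<lambda>j. real j / real K"
  have z: "exp_sum (\<lambda>j. - ?s j) K (int l) = 0 \<and> exp_sum (\<lambda>j. - ?s j) K (- int l) = 0"
    if "l \<in> {1..<K}" for l
  proof -
    have "exp_sum (\<lambda>j. - ?s j) K (- int l) = (\<Sum>j<K. expi2pi (real j * (real l / real K)))"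
      by (simp add: exp_sum_def mult.commute)
    also have "\<dots> = 0" using that by (intro sum_expi2pi_residues) auto
    finally have "exp_sum (\<lambda>j. - ?s j) K (- int l) = 0" .
    moreover from this have "norm (exp_sum (\<lambda>j. - ?s j) K (int l)) = 0"
      by (simp only: norm_exp_sum_minus[symmetric, of _ _ "int l"] norm_zero)
    ultimately show ?thesis by (simp only: norm_eq_zero)
  qed
  have "complex_of_real (\<Sum>x<1::nat. \<Sum>j<K. fejer K ((\<lambda>_. t) x - ?s j)) = 1"
    unfolding fejer_double_sum using K z by (simp add: power2_eq_square)
  then show ?thesis
    unfolding of_real_eq_1_iff by simp
qed

lemma fejer_double_sum_deviation:
  assumes K: "K > 0"
  shows "\<bar>(\<Sum>x<B. \<Sum>j<N. fejer K (f x - s j)) - real B * real N / real K\<bar>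
     \<le> 2 / (real K)\<^sup>2 * (\<Sum>l=1..<K. real (K - l) * (norm (exp_sum f B (int l))
            * norm (exp_sum (\<lambda>j. - s j) N (int l))))"
proof -
  let ?S = "exp_sum f B" and ?c = "exp_sum (\<lambda>j. - s j) N"
  let ?T = "\<Sum>l=1..<K. of_nat (K - l) * (?S (int l) * ?c (int l) + ?S (- int l) * ?c (- int l))"
  have main: "of_nat K * of_nat B * of_nat N / (of_nat K)\<^sup>2 = complex_of_real (real B * real N / real K)"
    using K by (simp add: power2_eq_square)
  have "complex_of_real ((\<Sum>x<B. \<Sum>j<N. fejer K (f x - s j)) - real B * real N / real K)
     = ?T / (of_nat K)\<^sup>2"
    unfolding of_real_diff fejer_double_sum add_divide_distrib main by simp
  then have eq: "\<bar>(\<Sum>x<B. \<Sum>j<N. fejer K (f x - s j)) - real B * real N / real K\<bar>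
     = norm ?T / (real K)\<^sup>2"
    by (simp only: norm_of_real[where 'a = complex, symmetric] norm_divide norm_power norm_of_nat)
  have "norm ?T \<le> (\<Sum>l=1..<K. real (K - l) * (2 * (norm (?S (int l)) * norm (?c (int l)))))"
  proof (rule sum_norm_le)
    fix l
    have "norm (?S (int l) * ?c (int l) + ?S (- int l) * ?c (- int l))
       \<le> 2 * (norm (?S (int l)) * norm (?c (int l)))"
      using norm_triangle_ineq[of "?S (int l) * ?c (int l)" "?S (- int l) * ?c (- int l)"]
      by (simp add: norm_mult norm_exp_sum_minus)
    then show "norm (of_nat (K - l) * (?S (int l) * ?c (int l) + ?S (- int l) * ?c (- int l)))
       \<le> real (K - l) * (2 * (norm (?S (int l)) * norm (?c (int l))))"
      by (simp add: norm_mult mult_left_mono)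
  qed
  also have "\<dots> = 2 * (\<Sum>l=1..<K. real (K - l) * (norm (?S (int l)) * norm (?c (int l))))"
    by (simp add: sum_distrib_left mult_ac)
  finally have "norm ?T / (real K)\<^sup>2
      \<le> 2 * (\<Sum>l=1..<K. real (K - l) * (norm (?S (int l)) * norm (?c (int l)))) / (real K)\<^sup>2"
    by (rule divide_right_mono) simp
  then show ?thesis unfolding eq by (simp only: times_divide_eq_left)
qed

section \<open>An inequality of Erdos--Turan type\<close>

text \<open>The size of the discrepancy, up to a logarithm: \<open>B/K\<close> is what a resolution of \<open>1/K\<close> costs, and the
  frequency \<open>l\<close> is weighted by the size \<open>1/l\<close> of the Fourier coefficients of an interval.\<close>

definition et_bound :: "(nat \<Rightarrow> real) \<Rightarrow> nat \<Rightarrow> nat \<Rightarrow> real" where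
  "et_bound f B K = real B / real K + (\<Sum>l=1..<K. norm (exp_sum f B (int l)) / real l)"

lemma et_bound_nonneg: "0 \<le> et_bound f B K"
  by (simp add: et_bound_def sum_nonneg)

text \<open>An upper bound for the number of points in a short arc needs only a majorant, and four times a
  single kernel is one.\<close>

lemma card_arc_le:
  assumes K: "K > 0"
  shows "real (card {x. x < B \<and> dist_nearest_int (f x - s) \<le> 1 / (6 * real K)}) \<le> 8 * et_bound f B K"
proof -
  let ?X = "{x. x < B \<and> dist_nearest_int (f x - s) \<le> 1 / (6 * real K)}"
  let ?S = "\<lambda>l. norm (exp_sum f B (int l))"
  have "real (card ?X) / 4 = (\<Sum>x\<in>?X. 1/4)" by simp
  also have "\<dots> \<le> (\<Sum>x\<in>?X. fejer K (f x - s))"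
    using K by (intro sum_mono fejer_ge_quarter) auto
  also have "\<dots> \<le> (\<Sum>x<B. fejer K (f x - s))"
    by (intro sum_mono2) (auto simp: fejer_nonneg)
  also have "\<dots> = (\<Sum>x<B. \<Sum>j<1::nat. fejer K (f x - (\<lambda>_. s) j))" by simp
  also have "\<dots> \<le> real B / real K
      + 2 / (real K)\<^sup>2 * (\<Sum>l=1..<K. real (K - l) * (?S l * norm (exp_sum (\<lambda>_. - s) 1 (int l))))"
    using fejer_double_sum_deviation[OF K, where f=f and B=B and N=1 and s="\<lambda>_. s"] by simp
  also have "\<dots> \<le> real B / real K + 2 / (real K)\<^sup>2 * (\<Sum>l=1..<K. (real K)\<^sup>2 * (?S l / real l))"
  proof (intro add_left_mono mult_left_mono sum_mono)
    fix l assume l: "l \<in> {1..<K}"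
    have "real (K - l) * real l \<le> real K * real K"
      using l by (intro mult_mono) auto
    then have "real (K - l) * real l * ?S l \<le> (real K)\<^sup>2 * ?S l"
      by (intro mult_right_mono) (auto simp: power2_eq_square)
    then show "real (K - l) * (?S l * norm (exp_sum (\<lambda>_. - s) 1 (int l))) \<le> (real K)\<^sup>2 * (?S l / real l)"
      using l by (simp add: exp_sum_def norm_expi2pi field_simps)
  qed simp
  also have "2 / (real K)\<^sup>2 * (\<Sum>l=1..<K. (real K)\<^sup>2 * (?S l / real l)) = 2 * (\<Sum>l=1..<K. ?S l / real l)"
    unfolding sum_distrib_left[symmetric] using K by simp
  finally have "real (card ?X) / 4 \<le> real B / real K + 2 * (\<Sum>l=1..<K. ?S l / real l)"
    .
  moreover have "0 \<le> real B / real K" by simp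
  moreover have "X \<le> 8 * (a + b)" if "X / 4 \<le> a + 2 * b" "0 \<le> a" for X a b :: real
    using that by simp
  ultimately show ?thesis unfolding et_bound_def by blast
qed

text \<open>Points at a prescribed distance from the boundary of \<open>{t. \<parallel>t\<parallel> < \<delta>}\<close> lie in four short
  arcs, one for each side of each of the two boundary points \<open>\<plusminus>\<delta>\<close>.\<close>

lemma card_near_boundary_le:
  assumes K: "K > 0"
  shows "real (card {x. x < B \<and> nat \<lfloor>3 * real K * \<bar>dist_nearest_int (f x) - \<delta>\<bar>\<rfloor> = i})
     \<le> 32 * et_bound f B K"
proof -
  let ?c = "\<lambda>\<sigma> \<tau>. \<sigma> * (\<delta> + \<tau> * ((2 * real i + 1) / (6 * real K)))"
  let ?A = "\<lambda>\<sigma> \<tau>. {x. x < B \<and> dist_nearest_int (f x - ?c \<sigma> \<tau>) \<le> 1 / (6 * real K)}"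
  let ?X = "{x. x < B \<and> nat \<lfloor>3 * real K * \<bar>dist_nearest_int (f x) - \<delta>\<bar>\<rfloor> = i}"
  have "?X \<subseteq> ?A 1 1 \<union> ?A 1 (-1) \<union> ?A (-1) 1 \<union> ?A (-1) (-1)"
  proof
    fix x assume x: "x \<in> ?X"
    define d where "d = dist_nearest_int (f x)"
    define r where "r = \<bar>d - \<delta>\<bar>"
    have "real i = of_int \<lfloor>3 * real K * r\<rfloor>" using x by (auto simp: r_def d_def)
    then have i: "real i \<le> 3 * real K * r" "3 * real K * r < real i + 1"
      by linarith+
    then have "real i / (3 * real K) \<le> r" "r \<le> (real i + 1) / (3 * real K)"
      using K by (auto simp: field_simps)
    moreover define c w where "c = (2 * real i + 1) / (6 * real K)" and "w = 1 / (6 * real K)"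
    have "real i / (3 * real K) = c - w" "(real i + 1) / (3 * real K) = c + w"
      using K by (auto simp: c_def w_def field_simps)
    ultimately have r: "\<bar>r - c\<bar> \<le> w"
      by linarith
    obtain q where q: "f x = of_int q + d \<or> f x = of_int q - d"
      unfolding d_def by (rule dist_nearest_int_obtain)
    have "\<exists>\<sigma>\<in>{1,-1}. \<exists>\<tau>\<in>{1,-1}. f x = of_int q + \<sigma> * (\<delta> + \<tau> * r)"
      using q by (auto simp: r_def abs_if)
    then obtain \<sigma> \<tau> where st: "\<sigma> \<in> {1,-1}" "\<tau> \<in> {1,-1}" "f x = of_int q + \<sigma> * (\<delta> + \<tau> * r)"
      by blast
    have "dist_nearest_int (f x - ?c \<sigma> \<tau>) \<le> \<bar>f x - ?c \<sigma> \<tau> - of_int q\<bar>"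
      by (rule dist_nearest_int_le)
    also have "f x - ?c \<sigma> \<tau> - of_int q = \<sigma> * \<tau> * (r - c)"
      unfolding st(3) c_def[symmetric] using st(1,2) by (simp add: algebra_simps)
    also have "\<bar>\<dots>\<bar> = \<bar>r - c\<bar>"
      using st by (auto simp: abs_mult)
    also have "\<dots> \<le> w" by (rule r)
    finally have "dist_nearest_int (f x - ?c \<sigma> \<tau>) \<le> 1 / (6 * real K)" by (simp only: w_def)
    then have "x \<in> ?A \<sigma> \<tau>" using x by blast
    then show "x \<in> ?A 1 1 \<union> ?A 1 (-1) \<union> ?A (-1) 1 \<union> ?A (-1) (-1)"
      using st by blast
  qed
  then have "card ?X \<le> card (?A 1 1 \<union> ?A 1 (-1) \<union> ?A (-1) 1 \<union> ?A (-1) (-1))"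
    by (intro card_mono) auto
  also have "\<dots> \<le> card (?A 1 1) + card (?A 1 (-1)) + card (?A (-1) 1) + card (?A (-1) (-1))"
    by (intro card_Un_le[THEN order_trans] add_mono order_refl)
  finally have "real (card ?X) \<le> real (card (?A 1 1)) + real (card (?A 1 (-1)))
      + real (card (?A (-1) 1)) + real (card (?A (-1) (-1)))"
    by linarith
  then show ?thesis
    using card_arc_le[OF K, of B f "?c 1 1"] card_arc_le[OF K, of B f "?c 1 (-1)"]
      card_arc_le[OF K, of B f "?c (-1) 1"] card_arc_le[OF K, of B f "?c (-1) (-1)"]
    by linarith
qed

lemma sum_inverse_squares_le:
  assumes "0 < k" "k \<le> n"
  shows "(\<Sum>i=k..n. 1 / (real i)\<^sup>2) \<le> 2 / real k - 1 / real n"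
  using assms(2)
proof (induction n rule: dec_induct)
  case base
  have "1 / (real k)\<^sup>2 \<le> 1 / real k"
    using assms(1) by (simp add: field_simps power2_eq_square)
  then show ?case by simp
next
  case (step n)
  then have "0 < n" using assms(1) by linarith
  then have "1 / (real (Suc n))\<^sup>2 \<le> 1 / (real n * real (Suc n))"
    by (intro divide_left_mono) (auto simp: power2_eq_square)
  also have "\<dots> = 1 / real n - 1 / real (Suc n)"
    using \<open>0 < n\<close> by (simp add: field_simps)
  finally have "1 / (real (Suc n))\<^sup>2 \<le> 1 / real n - 1 / real (Suc n)" .
  then show ?case using step by simp
qed

text \<open>At distance \<open>i/K\<close> the kernel is at most \<open>1/(4i\<^sup>2)\<close>, and at most two grid points lie at each such
  distance, so the tail of the partition of unity is the tail of a convergent series.\<close>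

lemma fejer_tail_le:
  assumes K: "K > 0" and k: "k > 0" and \<rho>: "real k \<le> real K * \<rho>"
  shows "(\<Sum>j | j < K \<and> \<rho> \<le> dist_nearest_int (t - real j / real K). fejer K (t - real j / real K))
     \<le> 1 / real k"
proof (cases "k \<le> K")
  case True
  let ?d = "\<lambda>j. dist_nearest_int (t - real j / real K)"
  let ?X = "{j. j < K \<and> \<rho> \<le> ?d j}"
  let ?\<kappa> = "\<lambda>j. nat \<lfloor>real K * ?d j\<rfloor>"
  have \<kappa>: "real (?\<kappa> j) \<le> real K * ?d j" for j
    by (simp add: dist_nearest_int_nonneg)
  have aux: "F \<le> 1 / 4 * (1 / y\<^sup>2)" if "0 < y" "4 * y\<^sup>2 * F \<le> 1" for F y :: real
    using that by (simp add: field_simps)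
  have low: "k \<le> ?\<kappa> j" if "j \<in> ?X" for j
  proof -
    have "real K * \<rho> \<le> real K * ?d j" using that by (intro mult_left_mono) auto
    then show ?thesis using \<rho> by (simp add: le_nat_floor)
  qed
  have "sum (\<lambda>j. fejer K (t - real j / real K)) ?X \<le> 2 * sum (\<lambda>i. 1 / 4 * (1 / (real i)\<^sup>2)) {k..K}"
  proof (rule sum_le_fibre_sum[where \<kappa> = ?\<kappa>])
    fix j assume j: "j \<in> ?X"
    have "real K * ?d j \<le> real K * 1"
      using dist_nearest_int_le_half[of "t - real j / real K"] by (intro mult_left_mono) auto
    then show "?\<kappa> j \<in> {k..K}" using low[OF j] by (simp add: nat_le_iff floor_le_iff)
    have "0 < ?\<kappa> j" using low[OF j] k by linarith
    then have pos: "0 < real (?\<kappa> j)" by (simp only: of_nat_0_less_iff)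
    have "4 * (real (?\<kappa> j))\<^sup>2 * fejer K (t - real j / real K)
        \<le> 4 * (real K * ?d j)\<^sup>2 * fejer K (t - real j / real K)"
      by (intro mult_right_mono mult_left_mono power_mono \<kappa> fejer_nonneg) auto
    also have "\<dots> \<le> 1" by (rule fejer_decay[OF K])
    finally show "fejer K (t - real j / real K) \<le> 1 / 4 * (1 / (real (?\<kappa> j))\<^sup>2)"
      using pos aux by blast
  next
    fix i
    \<comment> \<open>Unrolling the circle: the grid point \<open>j/K\<close> is moved to its translate closest to \<open>t\<close>.\<close>
    let ?N = "\<lambda>j. int j + int K * round (t - real j / real K)"
    have "card {j \<in> ?X. ?\<kappa> j = i} \<le> card {n::int. \<lfloor>\<bar>real K * t - of_int n\<bar>\<rfloor> = int i}"
    proof (rule card_inj_on_le[where f = ?N])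
      show "inj_on ?N {j \<in> ?X. ?\<kappa> j = i}"
      proof (rule inj_onI)
        fix j j' assume "j \<in> {j \<in> ?X. ?\<kappa> j = i}" "j' \<in> {j \<in> ?X. ?\<kappa> j = i}" "?N j = ?N j'"
        then have "int j mod int K = int j' mod int K" "j < K" "j' < K"
          by (metis mod_mult_self2, auto)
        then show "j = j'" by simp
      qed
      show "?N ` {j \<in> ?X. ?\<kappa> j = i} \<subseteq> {n. \<lfloor>\<bar>real K * t - of_int n\<bar>\<rfloor> = int i}"
      proof
        fix n assume "n \<in> ?N ` {j \<in> ?X. ?\<kappa> j = i}"
        then obtain j where j: "?\<kappa> j = i" "n = ?N j" by blast
        have "real K * ?d j = \<bar>real K * (t - real j / real K - of_int (round (t - real j / real K)))\<bar>"
          by (simp add: abs_mult dist_nearest_int_eq_round)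
        also have "real K * (t - real j / real K - of_int (round (t - real j / real K)))
          = real K * t - of_int n"
          unfolding j(2) using K by (simp add: algebra_simps)
        finally have "int (nat \<lfloor>\<bar>real K * t - of_int n\<bar>\<rfloor>) = int i"
          using j(1) by simp
        moreover have "0 \<le> \<lfloor>\<bar>real K * t - of_int n\<bar>\<rfloor>" by simp
        ultimately have "int i = \<lfloor>\<bar>real K * t - of_int n\<bar>\<rfloor>" by linarith
        then show "n \<in> {n. \<lfloor>\<bar>real K * t - of_int n\<bar>\<rfloor> = int i}" by simp
      qed
    qed (rule finite_integers_at_distance)
    then show "real (card {j \<in> ?X. ?\<kappa> j = i}) \<le> 2"
      using card_integers_at_distance_le[of "real K * t" "int i"] by linarith
  qed auto
  also have "\<dots> = 1 / 2 * (\<Sum>i=k..K. 1 / (real i)\<^sup>2)"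
    by (simp add: sum_distrib_left)
  also have "\<dots> \<le> 1 / 2 * (2 / real k)"
    using sum_inverse_squares_le[OF k True] by (intro mult_left_mono) (auto intro: order_trans)
  finally show ?thesis by simp
next
  case False
  have empty: "{j. j < K \<and> \<rho> \<le> dist_nearest_int (t - real j / real K)} = {}"
  proof -
    have "1 < \<rho>"
    proof (rule ccontr)
      assume "\<not> 1 < \<rho>"
      then have "real K * \<rho> \<le> real K * 1" by (intro mult_left_mono) auto
      then show False using \<rho> False by simp
    qed
    then have "dist_nearest_int (t - real j / real K) < \<rho>" for j
      using dist_nearest_int_le_half[of "t - real j / real K"] by linarith
    then show ?thesis by (simp add: not_le)
  qed
  show ?thesis unfolding empty by simp
qed

text \<open>The grid points \<open>(j - (A - 1)) / K\<close> with \<open>j < 2A - 1\<close> are exactly those of the \<open>K\<close> grid points whose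
  distance to the integers is less than \<open>\<delta>\<close>.  The sum of their kernels differs from the indicator
  function of \<open>{t. \<parallel>t\<parallel> < \<delta>}\<close> by a sum over grid points on the other side of the boundary, which is
  a tail of the partition of unity and therefore decays with the distance of \<open>t\<close> to the boundary.\<close>

lemma interval_weight_error:
  assumes K: "K > 0" and \<delta>: "0 < \<delta>" "\<delta> < 1/2" and A: "A = nat \<lceil>\<delta> * real K\<rceil>"
  defines "s \<equiv> \<lambda>j. (real j - real (A - 1)) / real K"
  shows "\<bar>of_bool (dist_nearest_int t < \<delta>) - (\<Sum>j<2 * A - 1. fejer K (t - s j))\<bar>
     \<le> 6 / (1 + real (nat \<lfloor>3 * real K * \<bar>dist_nearest_int t - \<delta>\<bar>\<rfloor>))"
proof -
  define N where "N = 2 * A - 1"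
  define \<rho> where "\<rho> = \<bar>dist_nearest_int t - \<delta>\<bar>"
  define k where "k = nat \<lfloor>3 * real K * \<rho>\<rfloor>"
  have \<delta>K: "0 < \<delta> * real K" using \<delta> K by simp
  have A1: "1 \<le> A" "\<delta> * real K \<le> real A" "real (A - 1) < \<delta> * real K"
    using \<delta>K unfolding A by linarith+
  have \<delta>_half: "\<delta> * real K < 1/2 * real K"
    using \<delta> K by (intro mult_strict_right_mono) auto
  have "real (A - 1) < real K / 2"
    using A1(3) \<delta>_half by linarith
  then have N_le: "N \<le> K" unfolding N_def by linarith
  have shift: "t - s j = (t + real (A - 1) / real K) - real j / real K" for j
    by (simp add: s_def diff_divide_distrib)
  define P where "P = (\<Sum>j<N. fejer K (t - s j))"
  define Q where "Q = (\<Sum>j=N..<K. fejer K (t - s j))"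
  have PQ: "P + Q = 1"
    using fejer_partition_of_unity[OF K, of "t + real (A - 1) / real K"] N_le
    unfolding P_def Q_def shift by (simp add: lessThan_atLeast0 sum.atLeastLessThan_concat)
  have PQ0: "0 \<le> P" "0 \<le> Q" by (simp_all add: P_def Q_def sum_nonneg fejer_nonneg)
  have inside: "dist_nearest_int (s j) < \<delta>" if "j < N" for j
  proof -
    have "\<bar>real j - real (A - 1)\<bar> \<le> real (A - 1)"
      using that A1(1) unfolding N_def by linarith
    then have "\<bar>s j\<bar> \<le> real (A - 1) / real K"
      using K by (simp add: s_def divide_right_mono)
    also have "\<dots> < \<delta>" using A1 K by (simp add: field_simps)
    finally show ?thesis using dist_nearest_int_le_abs[of "s j"] by linarith
  qed
  have outside: "\<delta> \<le> dist_nearest_int (s j)" if "N \<le> j" "j < K" for j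
  proof -
    have "\<delta> * real K \<le> real j - real (A - 1)" "real j - real (A - 1) \<le> real K - \<delta> * real K"
      using that A1 unfolding N_def by linarith+
    then have "of_int 0 + \<delta> \<le> s j" "s j \<le> of_int 0 + 1 - \<delta>"
      using K by (simp_all add: s_def field_simps)
    then show ?thesis by (rule dist_nearest_int_geI)
  qed
  have tri: "dist_nearest_int t \<le> dist_nearest_int (t - s j) + dist_nearest_int (s j)"
    "dist_nearest_int (s j) \<le> dist_nearest_int (t - s j) + dist_nearest_int t" for j
    using dist_nearest_int_triangle[of "t - s j" "s j"] dist_nearest_int_triangle[of "s j - t" t]
      dist_nearest_int_minus[of "t - s j"] by auto
  define e where "e = \<bar>of_bool (dist_nearest_int t < \<delta>) - P\<bar>"
  have e: "e = (if dist_nearest_int t < \<delta> then Q else P)"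
    using PQ PQ0 by (auto simp: e_def)
  \<comment> \<open>The tail bound applies from distance \<open>1/K\<close> on, that is for \<open>k \<ge> 3\<close>; for smaller \<open>k\<close> the bound exceeds \<open>1\<close>.\<close>
  have "e \<le> 6 / (1 + real k)"
  proof (cases "k < 3")
    case True
    have "e \<le> 1" unfolding e using PQ PQ0 by auto
    also have "1 \<le> 6 / (1 + real k)" using True by (simp add: field_simps)
    finally show ?thesis .
  next
    case False
    define k0 where "k0 = k div 3"
    have k0: "0 < k0" "k \<le> 3 * k0 + 2" "3 * k0 \<le> k" using False by (auto simp: k0_def)
    have "real k \<le> 3 * real K * \<rho>" by (simp add: k_def \<rho>_def)
    then have k0\<rho>: "real k0 \<le> real K * \<rho>" using k0(3) by linarith
    let ?T = "{j. j < K \<and> \<rho> \<le> dist_nearest_int ((t + real (A - 1) / real K) - real j / real K)}"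
    have "e \<le> (\<Sum>j\<in>?T. fejer K ((t + real (A - 1) / real K) - real j / real K))"
    proof (cases "dist_nearest_int t < \<delta>")
      case True
      have "{N..<K} \<subseteq> ?T"
        unfolding shift[symmetric]
      proof
        fix j assume "j \<in> {N..<K}"
        then show "j \<in> {j. j < K \<and> \<rho> \<le> dist_nearest_int (t - s j)}"
          using True outside[of j] tri(2)[of j] unfolding \<rho>_def by simp
      qed
      with True show ?thesis
        unfolding e Q_def shift by (simp del: of_nat_diff) (intro sum_mono2; simp add: fejer_nonneg)
    next
      case F: False
      have "{..<N} \<subseteq> ?T"
        unfolding shift[symmetric]
      proof
        fix j assume "j \<in> {..<N}"
        then show "j \<in> {j. j < K \<and> \<rho> \<le> dist_nearest_int (t - s j)}"
          using F inside[of j] tri(1)[of j] N_le unfolding \<rho>_def by simp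
      qed
      with F show ?thesis
        unfolding e P_def shift by (simp del: of_nat_diff) (intro sum_mono2; simp add: fejer_nonneg)
    qed
    also have "\<dots> \<le> 1 / real k0"
      by (rule fejer_tail_le[OF K k0(1) k0\<rho>])
    also have "\<dots> \<le> 6 / (1 + real k)"
      using k0 by (simp add: field_simps)
    finally show ?thesis .
  qed
  then show ?thesis by (simp add: e_def P_def N_def k_def \<rho>_def)
qed

text \<open>The indicator function is replaced by the sum of kernels.  Arranging the points by their distance
  to the boundary, in steps of \<open>1/(3K)\<close>, every step contains at most \<open>32 * et_bound f B K\<close> points, and
  the errors at these steps form a harmonic sum; this is the source of the logarithm.  The sum of
  kernels itself has the right mean up to \<open>et_bound f B K\<close>.\<close>

theorem erdos_turan_count:
  assumes K: "K > 0" and \<delta>: "0 < \<delta>" "\<delta> < 1/2"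
  shows "\<bar>real (card {x. x < B \<and> dist_nearest_int (f x) < \<delta>}) - 2 * \<delta> * real B\<bar>
     \<le> 193 * harm (2 * K) * et_bound f B K"
proof -
  define A where "A = nat \<lceil>\<delta> * real K\<rceil>"
  define N where "N = 2 * A - 1"
  define s where "s = (\<lambda>j. (real j - real (A - 1)) / real K)"
  let ?S = "\<lambda>l. norm (exp_sum f B (int l))" and ?c = "\<lambda>l. norm (exp_sum (\<lambda>j. - s j) N (int l))"
  define G where "G = (\<Sum>x<B. \<Sum>j<N. fejer K (f x - s j))"
  let ?\<kappa> = "\<lambda>x. nat \<lfloor>3 * real K * \<bar>dist_nearest_int (f x) - \<delta>\<bar>\<rfloor>"
  have \<delta>K: "0 < \<delta> * real K" using \<delta> K by simp

  have "real (card {x. x < B \<and> dist_nearest_int (f x) < \<delta>})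
      = (\<Sum>x<B. of_bool (dist_nearest_int (f x) < \<delta>))"
    by (simp add: sum.If_cases of_bool_def Int_def)
  then have "\<bar>real (card {x. x < B \<and> dist_nearest_int (f x) < \<delta>}) - G\<bar>
      = \<bar>\<Sum>x<B. of_bool (dist_nearest_int (f x) < \<delta>) - (\<Sum>j<N. fejer K (f x - s j))\<bar>"
    by (simp add: G_def sum_subtractf)
  also have "\<dots> \<le> (\<Sum>x<B. 6 / (1 + real (?\<kappa> x)))"
    using interval_weight_error[OF K \<delta> A_def] unfolding s_def N_def
    by (intro sum_abs[THEN order_trans] sum_mono)
  also have "\<dots> \<le> 32 * et_bound f B K * (\<Sum>i<2 * K. 6 / (1 + real i))"
  proof (rule sum_le_fibre_sum[where \<kappa> = ?\<kappa>])
    fix x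
    have "\<bar>dist_nearest_int (f x) - \<delta>\<bar> \<le> 1/2"
      using dist_nearest_int_nonneg[of "f x"] dist_nearest_int_le_half[of "f x"] \<delta> by linarith
    then have "3 * real K * \<bar>dist_nearest_int (f x) - \<delta>\<bar> \<le> 3 * real K * (1/2)"
      by (intro mult_left_mono) auto
    also have "\<dots> < 2 * real K" using K by simp
    finally show "?\<kappa> x \<in> {..<2 * K}"
      by (simp add: nat_less_iff floor_less_iff)
  next
    fix i
    show "real (card {x \<in> {..<B}. ?\<kappa> x = i}) \<le> 32 * et_bound f B K"
      using card_near_boundary_le[OF K, of B f \<delta> i] by simp
  qed auto
  also have "(\<Sum>i<2 * K. 6 / (1 + real i)) = 6 * harm (2 * K)"
    unfolding sum_inverse_Suc_eq_harm[symmetric] by (simp add: sum_distrib_left)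
  finally have 1: "\<bar>real (card {x. x < B \<and> dist_nearest_int (f x) < \<delta>}) - G\<bar>
      \<le> 192 * harm (2 * K) * et_bound f B K"
    by (simp add: mult_ac)

  have "\<bar>G - real B * real N / real K\<bar> \<le> 2 / (real K)\<^sup>2 * (\<Sum>l=1..<K. real (K - l) * (?S l * ?c l))"
    unfolding G_def by (rule fejer_double_sum_deviation[OF K])
  also have "\<dots> \<le> (\<Sum>l=1..<K. ?S l / real l)"
    unfolding sum_distrib_left
  proof (rule sum_mono)
    fix l assume l: "l \<in> {1..<K}"
    \<comment> \<open>The geometric series over the grid is large for \<open>p\<close> near \<open>0\<close>, which accounts for the quotient
      \<open>1/l\<close>, and for \<open>p\<close> near \<open>1\<close>, where the triangular weight \<open>1 - p\<close> of the kernel compensates it.\<close>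
    define p where "p = real l / real K"
    have p: "0 < p" "p < 1" using l by (auto simp: p_def)
    have "p * (1 - p) \<le> dist_nearest_int p"
    proof (rule dist_nearest_int_geI[of 0])
      show "of_int 0 + p * (1 - p) \<le> p" using p by (simp add: algebra_simps)
      have "p * (1 - p) \<le> 1 * (1 - p)" using p by (intro mult_right_mono) auto
      then show "p \<le> of_int 0 + 1 - p * (1 - p)" by simp
    qed
    have "exp_sum (\<lambda>j. - s j) N (int l) = (\<Sum>j<N. expi2pi (real j * (- p) + p * real (A - 1)))"
      unfolding exp_sum_def s_def p_def using K by (intro sum.cong refl arg_cong[of _ _ expi2pi]) (simp add: field_simps)
    then have "2 * dist_nearest_int p * ?c l \<le> 1"
      using norm_sum_expi2pi_progression_le[of "- p" "p * real (A - 1)" N] by (simp add: dist_nearest_int_minus)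
    moreover have "2 * (p * (1 - p)) * ?c l \<le> 2 * dist_nearest_int p * ?c l"
      using \<open>p * (1 - p) \<le> dist_nearest_int p\<close> by (intro mult_right_mono) auto
    ultimately have "2 * (p * (1 - p)) * ?c l * ?S l \<le> 1 * ?S l"
      by (intro mult_right_mono) auto
    moreover have "2 / (real K)\<^sup>2 * (real (K - l) * (?S l * ?c l)) * real l = 2 * (p * (1 - p)) * ?c l * ?S l"
      using l by (simp add: p_def of_nat_diff field_simps power2_eq_square)
    ultimately have "2 / (real K)\<^sup>2 * (real (K - l) * (?S l * ?c l)) * real l \<le> ?S l" by linarith
    then show "2 / (real K)\<^sup>2 * (real (K - l) * (?S l * ?c l)) \<le> ?S l / real l"
      using l by (subst pos_le_divide_eq) auto
  qed
  finally have 2: "\<bar>G - real B * real N / real K\<bar> \<le> (\<Sum>l=1..<K. ?S l / real l)" .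

  have "\<bar>real N - 2 * \<delta> * real K\<bar> \<le> 1"
    using \<delta>K unfolding N_def A_def by linarith
  then have "real B / real K * \<bar>real N - 2 * \<delta> * real K\<bar> \<le> real B / real K * 1"
    by (intro mult_left_mono) auto
  moreover have "real B / real K * \<bar>real N - 2 * \<delta> * real K\<bar> = \<bar>real B / real K * (real N - 2 * \<delta> * real K)\<bar>"
    by (simp add: abs_mult)
  moreover have eq: "real B / real K * (real N - 2 * \<delta> * real K) = real B * real N / real K - 2 * \<delta> * real B"
    using K by (simp add: field_simps)
  ultimately have 3: "\<bar>real B * real N / real K - 2 * \<delta> * real B\<bar> \<le> real B / real K"
    by (simp only: mult_1_right)

  have "harm 1 \<le> (harm (2 * K) :: real)" using K by (intro harm_mono) auto
  then have "1 * et_bound f B K \<le> harm (2 * K) * et_bound f B K"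
    by (intro mult_right_mono et_bound_nonneg) (simp add: harm_expand)
  moreover have "\<bar>G - real B * real N / real K\<bar> + \<bar>real B * real N / real K - 2 * \<delta> * real B\<bar> \<le> et_bound f B K"
    using 2 3 unfolding et_bound_def by linarith
  moreover have "\<bar>a - d\<bar> \<le> \<bar>a - b\<bar> + (\<bar>b - c\<bar> + \<bar>c - d\<bar>)" for a b c d :: real by linarith
  note this[of "real (card {x. x < B \<and> dist_nearest_int (f x) < \<delta>})" "2 * \<delta> * real B" G "real B * real N / real K"]
  ultimately show ?thesis using 1 unfolding mult.assoc by linarith
qed

section \<open>Weyl sums of quadratic polynomials\<close>

lemma norm_sum_squared_by_difference:
  fixes z :: "nat \<Rightarrow> complex"
  shows "(norm (\<Sum>x<B. z x))\<^sup>2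
    = (\<Sum>x<B. (norm (z x))\<^sup>2) + 2 * Re (\<Sum>h=1..<B. \<Sum>y<B - h. z (y + h) * cnj (z y))"
proof (induction B)
  case 0 then show ?case by simp
next
  case (Suc B)
  have "(\<Sum>h=1..<Suc B. \<Sum>y<Suc B - h. z (y + h) * cnj (z y))
      = (\<Sum>h=1..<Suc B. (\<Sum>y<B - h. z (y + h) * cnj (z y)) + z B * cnj (z (B - h)))"
    by (intro sum.cong refl) (auto simp: Suc_diff_le)
  also have "\<dots> = (\<Sum>h=1..<Suc B. \<Sum>y<B - h. z (y + h) * cnj (z y))
      + z B * (\<Sum>h=1..<Suc B. cnj (z (B - h)))"
    by (simp only: sum.distrib sum_distrib_left)
  also have "(\<Sum>h=1..<Suc B. \<Sum>y<B - h. z (y + h) * cnj (z y))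
      = (\<Sum>h=1..<B. \<Sum>y<B - h. z (y + h) * cnj (z y))"
    by (cases B) auto
  also have "(\<Sum>h=1..<Suc B. cnj (z (B - h))) = (\<Sum>x<B. cnj (z x))"
    by (rule sum.reindex_bij_witness[of _ "\<lambda>x. B - x" "\<lambda>x. B - x"]) auto
  finally have split: "(\<Sum>h=1..<Suc B. \<Sum>y<Suc B - h. z (y + h) * cnj (z y))
      = (\<Sum>h=1..<B. \<Sum>y<B - h. z (y + h) * cnj (z y)) + z B * cnj (\<Sum>x<B. z x)"
    by simp
  have add: "(norm (a + b))\<^sup>2 = (norm a)\<^sup>2 + (norm b)\<^sup>2 + 2 * Re (b * cnj a)" for a b :: complex
    unfolding cmod_power2 by (simp add: power2_eq_square algebra_simps)
  show ?case
    unfolding split lessThan_Suc using Suc.IH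
    by (simp add: add add.commute[of "z B"])
qed

text \<open>A substitute, up to a factor \<open>2\<close>, for \<open>min (2B) (1 / \<parallel>t\<parallel>)\<close> that needs no special case for
  integral \<open>t\<close>.\<close>

definition recip_cap :: "nat \<Rightarrow> real \<Rightarrow> real" where
  "recip_cap B t = 2 * real B / (1 + 2 * real B * dist_nearest_int t)"

lemma recip_cap_denom_pos: "0 < 1 + 2 * real B * dist_nearest_int t"
  by (intro add_pos_nonneg mult_nonneg_nonneg dist_nearest_int_nonneg) auto

lemma recip_cap_nonneg: "0 \<le> recip_cap B t"
  using recip_cap_denom_pos[of B t] by (simp add: recip_cap_def)

lemma recip_cap_minus: "recip_cap B (- t) = recip_cap B t"
  by (simp add: recip_cap_def dist_nearest_int_minus)

lemma recip_cap_le_length: "recip_cap B t \<le> 2 * real B"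
proof -
  have "2 * real B * 1 \<le> 2 * real B * (1 + 2 * real B * dist_nearest_int t)"
    by (intro mult_left_mono) (auto simp: dist_nearest_int_nonneg)
  then show ?thesis
    unfolding recip_cap_def using recip_cap_denom_pos[of B t] by (simp add: pos_divide_le_eq)
qed

lemma recip_cap_le_inverse:
  assumes "0 < c" "c \<le> dist_nearest_int t"
  shows "recip_cap B t \<le> 1 / c"
proof -
  have "2 * real B * c \<le> 2 * real B * dist_nearest_int t"
    using assms by (intro mult_left_mono) auto
  then have "2 * real B * c \<le> 1 + 2 * real B * dist_nearest_int t" by simp
  then show ?thesis
    unfolding recip_cap_def using recip_cap_denom_pos[of B t] assms by (simp add: field_simps)
qed

lemma norm_progression_le_recip_cap:
  assumes "n \<le> B"
  shows "norm (\<Sum>k<n. expi2pi (real k * t + c)) \<le> recip_cap B t"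
proof -
  let ?s = "norm (\<Sum>k<n. expi2pi (real k * t + c))"
  have "?s \<le> real n" by (rule norm_sum_expi2pi_le)
  then have "?s \<le> real B" using assms by linarith
  moreover have "real B * (2 * dist_nearest_int t * ?s) \<le> real B * 1"
    by (intro mult_left_mono norm_sum_expi2pi_progression_le) auto
  ultimately have "?s * (1 + 2 * real B * dist_nearest_int t) \<le> 2 * real B"
    by (simp add: algebra_simps)
  then show ?thesis
    unfolding recip_cap_def using recip_cap_denom_pos[of B t] by (simp add: pos_le_divide_eq)
qed

text \<open>For a quadratic polynomial \<open>f\<close> the difference \<open>f (y + h) - f y\<close> is linear in \<open>y\<close>, so the inner
  sums are geometric.\<close>

lemma weyl_differencing:
  fixes \<theta> \<beta> c :: real
  defines "f \<equiv> \<lambda>x::nat. \<theta> * (real x)\<^sup>2 + \<beta> * real x + c"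
  shows "(norm (exp_sum f B (int m)))\<^sup>2
    \<le> real B + 2 * (\<Sum>h=1..<B. recip_cap B (real (m * h) * (2 * \<theta>)))"
proof -
  define z where "z x = expi2pi (of_int (int m) * f x)" for x
  have "(norm (exp_sum f B (int m)))\<^sup>2
      = real B + 2 * Re (\<Sum>h=1..<B. \<Sum>y<B - h. z (y + h) * cnj (z y))"
    using norm_sum_squared_by_difference[of z B] by (simp add: exp_sum_def z_def norm_expi2pi)
  also have "Re (\<Sum>h=1..<B. \<Sum>y<B - h. z (y + h) * cnj (z y))
      \<le> norm (\<Sum>h=1..<B. \<Sum>y<B - h. z (y + h) * cnj (z y))"
    by (rule complex_Re_le_cmod)
  also have "\<dots> \<le> (\<Sum>h=1..<B. recip_cap B (real (m * h) * (2 * \<theta>)))"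
  proof (rule sum_norm_le)
    fix h
    have "z (y + h) * cnj (z y)
        = expi2pi (real y * (real (m * h) * (2 * \<theta>)) + real m * (\<theta> * (real h)\<^sup>2 + \<beta> * real h))" for y
      unfolding z_def cnj_expi2pi expi2pi_add[symmetric] f_def
      by (rule arg_cong[of _ _ expi2pi]) (simp add: power2_eq_square algebra_simps)
    then show "norm (\<Sum>y<B - h. z (y + h) * cnj (z y)) \<le> recip_cap B (real (m * h) * (2 * \<theta>))"
      by (simp only: norm_progression_le_recip_cap diff_le_self)
  qed
  finally show ?thesis by simp
qed

text \<open>The points \<open>n \<tau>\<close> with \<open>n\<close> in a block of length \<open>B\<close> round to at most \<open>B \<tau> + 2\<close> different integers.
  Those which round to the same integer are spaced by \<open>\<tau>\<close>, so the reciprocals of their distances to it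
  form a harmonic sum of length about \<open>1/(2\<tau>)\<close>, apart from two terms bounded by \<open>2B\<close>.\<close>

lemma recip_cap_block_sum:
  fixes \<tau> :: real
  assumes \<tau>: "\<tau> > 0" and B: "B > 0"
  shows "(\<Sum>n=n0..<n0 + B. recip_cap B (real n * \<tau>))
    \<le> (real B * \<tau> + 2) * (4 * real B + 2 / \<tau> * harm (nat \<lfloor>1 / (2 * \<tau>)\<rfloor>))"
proof -
  let ?M = "nat \<lfloor>1 / (2 * \<tau>)\<rfloor>"
  define q where "q n = round (real n * \<tau>)" for n
  define i where "i n = nat \<lfloor>\<bar>of_int (q n) / \<tau> - of_int (int n)\<bar>\<rfloor>" for n
  define w where "w k = (if k = 0 then 2 * real B else 1 / (\<tau> * real k))" for k :: nat
  let ?Q = "{q n0..q (n0 + B - 1)}"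
  have dist: "dist_nearest_int (real n * \<tau>) = \<tau> * \<bar>of_int (q n) / \<tau> - of_int (int n)\<bar>" for n
  proof -
    have "\<tau> * \<bar>of_int (q n) / \<tau> - of_int (int n)\<bar> = \<bar>\<tau> * (of_int (q n) / \<tau> - of_int (int n))\<bar>"
      using \<tau> by (simp only: abs_mult abs_of_pos)
    also have "\<tau> * (of_int (q n) / \<tau> - of_int (int n)) = of_int (q n) - real n * \<tau>"
      using \<tau> by (simp add: field_simps)
    finally show ?thesis by (simp add: dist_nearest_int_eq_round q_def abs_minus_commute)
  qed
  have i_le: "real (i n) \<le> \<bar>of_int (q n) / \<tau> - of_int (int n)\<bar>" for n
    by (simp add: i_def)
  have "(\<Sum>n=n0..<n0 + B. recip_cap B (real n * \<tau>)) \<le> 2 * (\<Sum>(p, k)\<in>?Q \<times> {0..?M}. w k)"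
  proof (rule sum_le_fibre_sum[where \<kappa> = "\<lambda>n. (q n, i n)"])
    fix n assume n: "n \<in> {n0..<n0 + B}"
    have "real n0 * \<tau> \<le> real n * \<tau>" "real n * \<tau> \<le> real (n0 + B - 1) * \<tau>"
      using n \<tau> by (auto intro!: mult_right_mono)
    then have "q n \<in> ?Q" by (auto simp: q_def intro: round_mono)
    moreover have "\<tau> * \<bar>of_int (q n) / \<tau> - of_int (int n)\<bar> \<le> 1/2"
      using dist_nearest_int_le_half[of "real n * \<tau>"] by (simp only: dist)
    then have "\<bar>of_int (q n) / \<tau> - of_int (int n)\<bar> \<le> 1 / (2 * \<tau>)"
      using \<tau> by (simp add: field_simps)
    then have "i n \<le> ?M" unfolding i_def by (intro nat_mono floor_mono)
    ultimately show "(q n, i n) \<in> ?Q \<times> {0..?M}" by simp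
    show "recip_cap B (real n * \<tau>) \<le> (case (q n, i n) of (p, k) \<Rightarrow> w k)"
    proof (cases "i n = 0")
      case True then show ?thesis by (simp add: w_def recip_cap_le_length)
    next
      case False
      have "\<tau> * real (i n) \<le> dist_nearest_int (real n * \<tau>)"
        unfolding dist using \<tau> by (intro mult_left_mono i_le) auto
      then show ?thesis using False \<tau> by (simp add: w_def recip_cap_le_inverse)
    qed
  next
    fix pk assume "pk \<in> ?Q \<times> {0..?M}"
    obtain p k where pk: "pk = (p, k)" by (cases pk)
    show "0 \<le> (case pk of (p, k) \<Rightarrow> w k)" using \<tau> by (simp add: pk w_def)
    have "card {n \<in> {n0..<n0 + B}. (q n, i n) = pk} \<le> card {n::int. \<lfloor>\<bar>of_int p / \<tau> - of_int n\<bar>\<rfloor> = int k}"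
    proof (rule card_inj_on_le[where f = int])
      show "int ` {n \<in> {n0..<n0 + B}. (q n, i n) = pk} \<subseteq> {n. \<lfloor>\<bar>of_int p / \<tau> - of_int n\<bar>\<rfloor> = int k}"
        by (auto simp: pk i_def)
    qed (auto simp: finite_integers_at_distance)
    then show "real (card {n \<in> {n0..<n0 + B}. (q n, i n) = pk}) \<le> 2"
      using card_integers_at_distance_le[of "of_int p / \<tau>" "int k"] by linarith
  qed auto
  also have "(\<Sum>(p, k)\<in>?Q \<times> {0..?M}. w k) = real (card ?Q) * (\<Sum>k=0..?M. w k)"
    by (simp add: sum.cartesian_product[symmetric])
  also have "(\<Sum>k=0..?M. w k) = 2 * real B + 1 / \<tau> * harm ?M"
    by (simp add: w_def sum.atLeast_Suc_atMost harm_def sum_distrib_left inverse_eq_divide)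
  also have "2 * (real (card ?Q) * (2 * real B + 1 / \<tau> * harm ?M))
      = real (card ?Q) * (4 * real B + 2 / \<tau> * harm ?M)"
    by (simp add: algebra_simps)
  also have "\<dots> \<le> (real B * \<tau> + 2) * (4 * real B + 2 / \<tau> * harm ?M)"
  proof (rule mult_right_mono)
    have "real (n0 + B - 1) * \<tau> = real n0 * \<tau> + real B * \<tau> - \<tau>"
      using B by (simp add: of_nat_diff algebra_simps)
    moreover have "of_int (q (n0 + B - 1)) \<le> real (n0 + B - 1) * \<tau> + 1/2"
      unfolding q_def by (rule of_int_round_le)
    moreover have "real n0 * \<tau> - 1/2 \<le> of_int (q n0)"
      unfolding q_def by (rule of_int_round_ge)
    ultimately have "of_int (q (n0 + B - 1)) - of_int (q n0) + 1 \<le> real B * \<tau> + 2"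
      using \<tau> by linarith
    moreover have "0 \<le> real B * \<tau> + 2" using \<tau> by simp
    ultimately show "real (card ?Q) \<le> real B * \<tau> + 2"
      by (simp add: of_nat_nat)
    show "0 \<le> 4 * real B + 2 / \<tau> * harm ?M" using \<tau> by (simp add: harm_nonneg)
  qed
  finally show ?thesis .
qed

text \<open>After differencing, the frequency \<open>m\<close> and the shift \<open>h\<close> enter only through their product
  \<open>n = m h\<close>, and a value \<open>n\<close> is taken at most as often as it has divisors.  Since \<open>h < B\<close>, the weight
  \<open>1/m\<close> is at most \<open>1/(1 + n div B)\<close>; this majorant is constant on blocks of length \<open>B\<close>, and the block
  sums are added with harmonic weights.\<close>

lemma weighted_weyl_mean_square:
  fixes \<theta> \<beta> c D :: real
  defines "f \<equiv> \<lambda>x::nat. \<theta> * (real x)\<^sup>2 + \<beta> * real x + c" and "\<tau> \<equiv> 2 * \<bar>\<theta>\<bar>"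
  assumes \<theta>: "\<theta> \<noteq> 0" and B: "B > 0" and D0: "0 \<le> D"
    and D: "\<And>n. 0 < n \<Longrightarrow> n < K * B \<Longrightarrow> real (card {d. d dvd n}) \<le> D"
  shows "(\<Sum>m=1..<K. (norm (exp_sum f B (int m)))\<^sup>2 / real m)
    \<le> harm K * (real B + 2 * D * ((real B * \<tau> + 2) * (4 * real B + 2 / \<tau> * harm (nat \<lfloor>1 / (2 * \<tau>)\<rfloor>))))"
proof -
  let ?block = "(real B * \<tau> + 2) * (4 * real B + 2 / \<tau> * harm (nat \<lfloor>1 / (2 * \<tau>)\<rfloor>))"
  have \<tau>: "\<tau> > 0" using \<theta> by (simp add: \<tau>_def)
  have cap_abs: "recip_cap B (real n * (2 * \<theta>)) = recip_cap B (real n * \<tau>)" for n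
    using recip_cap_minus[of B "real n * (2 * \<theta>)"] by (auto simp: \<tau>_def abs_if)
  let ?g = "\<lambda>m h. recip_cap B (real (m * h) * \<tau>)"
  define w where "w n = recip_cap B (real n * \<tau>) / (1 + real (n div B))" for n
  have w0: "0 \<le> w n" for n by (simp add: w_def recip_cap_nonneg)

  have "(\<Sum>(m, h)\<in>{1..<K} \<times> {1..<B}. ?g m h / real m) \<le> D * sum w {1..<K * B}"
  proof (rule sum_le_fibre_sum[where \<kappa> = "\<lambda>(m, h). m * h"])
    fix x assume "x \<in> {1..<K} \<times> {1..<B}"
    then obtain m h where x: "x = (m, h)" "1 \<le> m" "m < K" "1 \<le> h" "h < B" by auto
    then have "m * h < K * B" by (intro mult_strict_mono) auto
    then show "(case x of (m, h) \<Rightarrow> m * h) \<in> {1..<K * B}" using x by simp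
    have "m * h < m * B" using x by simp
    then have "m * h div B < m" using B by (simp add: div_less_iff_less_mult)
    then have "1 + real (m * h div B) \<le> real m" by linarith
    then show "(case x of (m, h) \<Rightarrow> ?g m h / real m) \<le> w (case x of (m, h) \<Rightarrow> m * h)"
      unfolding x w_def by (simp only: case_prod_conv) (intro divide_left_mono recip_cap_nonneg; auto)
  next
    fix n assume n: "n \<in> {1..<K * B}"
    have "card {x \<in> {1..<K} \<times> {1..<B}. (case x of (m, h) \<Rightarrow> m * h) = n} \<le> card {d. d dvd n}"
    proof (rule card_inj_on_le[where f = fst])
      show "inj_on fst {x \<in> {1..<K} \<times> {1..<B}. (case x of (m, h) \<Rightarrow> m * h) = n}"
        by (auto simp: inj_on_def)
    qed (use n in auto)
    then show "real (card {x \<in> {1..<K} \<times> {1..<B}. (case x of (m, h) \<Rightarrow> m * h) = n}) \<le> D"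
      using D[of n] n by auto
  qed (auto simp: w0)
  also have "\<dots> \<le> D * sum w {..<K * B}"
    by (intro mult_left_mono sum_mono2 D0) (auto simp: w0)
  also have "sum w {..<K * B} = (\<Sum>k<K. \<Sum>n=k * B..<k * B + B. w n)"
    by (rule sum.nat_group[symmetric])
  also have "D * (\<Sum>k<K. \<Sum>n=k * B..<k * B + B. w n) \<le> D * (\<Sum>k<K. 1 / (1 + real k) * ?block)"
  proof (intro mult_left_mono sum_mono D0)
    fix k
    have "(\<Sum>n=k * B..<k * B + B. w n) = (\<Sum>n=k * B..<k * B + B. 1 / (1 + real k) * recip_cap B (real n * \<tau>))"
    proof (rule sum.cong[OF refl])
      fix n assume "n \<in> {k * B..<k * B + B}"
      then have "n div B = k" by (intro div_nat_eqI) (auto simp: mult.commute)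
      then show "w n = 1 / (1 + real k) * recip_cap B (real n * \<tau>)" by (simp add: w_def)
    qed
    also have "\<dots> \<le> 1 / (1 + real k) * ?block"
      unfolding sum_distrib_left[symmetric]
      by (intro mult_left_mono recip_cap_block_sum \<tau> B) auto
    finally show "(\<Sum>n=k * B..<k * B + B. w n) \<le> 1 / (1 + real k) * ?block" .
  qed
  also have "(\<Sum>k<K. 1 / (1 + real k) * ?block) = harm K * ?block"
    by (simp only: sum_distrib_right[symmetric] sum_inverse_Suc_eq_harm)
  finally have double: "(\<Sum>(m, h)\<in>{1..<K} \<times> {1..<B}. ?g m h / real m) \<le> D * (harm K * ?block)" .

  have "(\<Sum>m=1..<K. (norm (exp_sum f B (int m)))\<^sup>2 / real m)
      \<le> (\<Sum>m=1..<K. (real B + 2 * (\<Sum>h=1..<B. ?g m h)) / real m)"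
  proof (intro sum_mono divide_right_mono)
    fix m
    show "(norm (exp_sum f B (int m)))\<^sup>2 \<le> real B + 2 * (\<Sum>h=1..<B. ?g m h)"
      using weyl_differencing[of \<theta> \<beta> c B m] unfolding f_def cap_abs .
  qed simp
  also have "\<dots> = real B * (\<Sum>m=1..<K. 1 / real m) + 2 * (\<Sum>m=1..<K. \<Sum>h=1..<B. ?g m h / real m)"
    by (simp add: add_divide_distrib sum.distrib sum_distrib_left sum_divide_distrib)
  also have "\<dots> \<le> real B * harm K + 2 * (D * (harm K * ?block))"
  proof (intro add_mono mult_left_mono)
    show "(\<Sum>m=1..<K. 1 / real m) \<le> harm K"
      unfolding harm_def by (simp only: inverse_eq_divide) (intro sum_mono2; auto)
    show "(\<Sum>m=1..<K. \<Sum>h=1..<B. ?g m h / real m) \<le> D * (harm K * ?block)"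
      using double by (simp only: sum.cartesian_product)
  qed auto
  also have "\<dots> = harm K * (real B + 2 * D * ?block)"
    by (simp only: distrib_left mult_ac)
  finally show ?thesis .
qed

section \<open>The maximal order of the divisor function\<close>

text \<open>A divisor is determined by its exponents at the primes dividing \<open>n\<close>.\<close>

lemma card_divisors_le_prod:
  fixes n :: nat
  assumes n: "n > 0"
  shows "card {d. d dvd n} \<le> (\<Prod>p\<in>prime_factors n. multiplicity p n + 1)"
proof -
  let ?T = "\<Pi>\<^sub>E p\<in>prime_factors n. {..multiplicity p n}"
  let ?e = "\<lambda>d. \<lambda>p\<in>prime_factors n. multiplicity p d"
  have "card {d. d dvd n} \<le> card ?T"
  proof (rule card_inj_on_le[where f = ?e])
    show "inj_on ?e {d. d dvd n}"
    proof (rule inj_onI)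
      fix d d' assume d: "d \<in> {d. d dvd n}" "d' \<in> {d. d dvd n}" and eq: "?e d = ?e d'"
      show "d = d'"
      proof (rule multiplicity_eq_nat)
        show "d > 0" "d' > 0" using d n by (auto intro: dvd_pos_nat)
        fix p :: nat assume p: "prime p"
        show "multiplicity p d = multiplicity p d'"
        proof (cases "p dvd n")
          case True
          then have "p \<in> prime_factors n" using p n by (simp add: prime_factors_dvd)
          then show ?thesis using fun_cong[OF eq, of p] by simp
        next
          case False
          then have "\<not> p dvd d" "\<not> p dvd d'" using d dvd_trans by blast+
          then show ?thesis by (simp add: not_dvd_imp_multiplicity_0)
        qed
      qed
    qed
    show "?e ` {d. d dvd n} \<subseteq> ?T"
      using n by (auto intro!: dvd_imp_multiplicity_le)
    show "finite ?T" by (intro finite_PiE) auto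
  qed
  also have "card ?T = (\<Prod>p\<in>prime_factors n. multiplicity p n + 1)"
    by (simp add: card_PiE)
  finally show ?thesis .
qed

text \<open>The factor \<open>e + 1\<close> of a prime power \<open>p\<^sup>e\<close> is estimated in two ways: by \<open>1 + log\<^sub>2 n\<close> for the at most
  \<open>y\<close> primes \<open>p \<le> y\<close>, and by \<open>2\<^sup>e\<close> for the other primes; this is the power of \<open>p\<^sup>e\<close> with
  exponent \<open>ln 2 / ln p < ln 2 / ln y\<close>.\<close>

lemma card_divisors_le:
  fixes n :: nat and y :: real
  assumes n: "n > 0" and y: "y > 1"
  shows "real (card {d. d dvd n}) \<le> (1 + ln (real n) / ln 2) powr y * real n powr (ln 2 / ln y)"
proof -
  let ?P = "prime_factors n" and ?L = "1 + ln (real n) / ln 2" and ?s = "ln 2 / ln y"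
  have s: "0 < ?s" using y by simp
  have L: "1 \<le> ?L" using n by simp
  have factor: "real (multiplicity p n + 1)
      \<le> (if real p \<le> y then ?L else 1) * (real p ^ multiplicity p n) powr ?s" if p: "p \<in> ?P" for p
  proof -
    let ?e = "multiplicity p n"
    have p2: "2 \<le> p" using p by (auto intro: prime_ge_2_nat)
    have "p ^ ?e \<le> n" using n by (intro dvd_imp_le multiplicity_dvd) auto
    then have pn: "real p ^ ?e \<le> real n" by (metis of_nat_le_iff of_nat_power)
    show ?thesis
    proof (cases "real p \<le> y")
      case True
      have "(2::real) ^ ?e \<le> real p ^ ?e" using p2 by (intro power_mono) auto
      with pn have "(2::real) ^ ?e \<le> real n" by linarith
      then have "ln ((2::real) ^ ?e) \<le> ln (real n)" using n by (subst ln_le_cancel_iff) auto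
      then have "real ?e \<le> ln (real n) / ln 2" by (simp add: ln_realpow field_simps)
      then have "real (?e + 1) \<le> ?L * 1" by simp
      also have "\<dots> \<le> ?L * (real p ^ ?e) powr ?s"
        using L p2 s by (intro mult_left_mono ge_one_powr_ge_zero one_le_power) auto
      finally show ?thesis using True by simp
    next
      case False
      have "?e + 1 \<le> 2 ^ ?e" by (simp only: Suc_eq_plus1[symmetric] Suc_le_eq less_exp)
      then have "real (?e + 1) \<le> 2 ^ ?e" by (metis of_nat_le_iff of_nat_numeral of_nat_power)
      also have "(2::real) ^ ?e = exp (real ?e * ln 2)" by (simp add: exp_of_nat_mult)
      also have "real ?e * ln 2 \<le> real ?e * (?s * ln (real p))"
      proof (rule mult_left_mono)
        have "ln y \<le> ln (real p)" using False y by simp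
        then show "ln 2 \<le> ?s * ln (real p)" using y by (simp add: field_simps)
      qed simp
      also have "exp (real ?e * (?s * ln (real p))) = (real p ^ ?e) powr ?s"
        using p2 by (simp add: powr_def ln_realpow mult_ac)
      finally show ?thesis using False by simp
    qed
  qed
  have "real (card {d. d dvd n}) \<le> real (\<Prod>p\<in>?P. multiplicity p n + 1)"
    using card_divisors_le_prod[OF n] by (rule of_nat_mono)
  also have "\<dots> \<le> (\<Prod>p\<in>?P. (if real p \<le> y then ?L else 1) * (real p ^ multiplicity p n) powr ?s)"
    unfolding of_nat_prod by (intro prod_mono conjI factor) auto
  also have "\<dots> = (\<Prod>p\<in>?P. if real p \<le> y then ?L else 1) * (\<Prod>p\<in>?P. real p ^ multiplicity p n) powr ?s"
    by (simp add: prod.distrib prod_powr_distrib)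
  also have "(\<Prod>p\<in>?P. real p ^ multiplicity p n) = real n"
    using prime_factorization_nat[of n] n by (metis (no_types, lifting) of_nat_power of_nat_prod prod.cong)
  also have "(\<Prod>p\<in>?P. if real p \<le> y then ?L else 1) = ?L ^ card {p\<in>?P. real p \<le> y}"
    by (simp add: prod.If_cases Int_def)
  also have "\<dots> = ?L powr real (card {p\<in>?P. real p \<le> y})"
    using L by (simp add: powr_realpow)
  also have "\<dots> \<le> ?L powr y"
  proof (rule powr_mono)
    have "{p\<in>?P. real p \<le> y} \<subseteq> {1..nat \<lfloor>y\<rfloor>}"
      by (auto simp: le_nat_floor Suc_le_eq dest!: in_prime_factors_imp_prime prime_gt_0_nat)
    then have "card {p\<in>?P. real p \<le> y} \<le> card {1..nat \<lfloor>y\<rfloor>}" by (intro card_mono) auto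
    then show "real (card {p\<in>?P. real p \<le> y}) \<le> y" using y by (simp add: nat_le_iff) linarith
  qed (rule L)
  finally show ?thesis by (simp add: mult_right_mono)
qed

text \<open>With \<open>u = ln X\<close> the choice \<open>y = u / (ln u)\<^sup>3\<close> makes \<open>y * ln u\<close> negligible against \<open>u / ln u\<close>, while
  \<open>ln y\<close> is still asymptotic to \<open>ln u\<close>.  This is what yields the constant \<open>ln 2\<close>, and it leaves room
  for any power of \<open>1 + u\<close>.\<close>

lemma divisor_exponent_eventually:
  fixes \<epsilon> r :: real
  assumes "\<epsilon> > 0"
  shows "eventually (\<lambda>u. u / ln u ^ 3 * ln (1 + u / ln 2) + ln 2 / ln (u / ln u ^ 3) * u + r * ln (1 + u)
      \<le> (ln 2 + \<epsilon>) * u / ln u) at_top"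
proof -
  have "((\<lambda>u::real. (u / ln u ^ 3 * ln (1 + u / ln 2) + ln 2 / ln (u / ln u ^ 3) * u + r * ln (1 + u))
      / (u / ln u)) \<longlongrightarrow> ln 2) at_top"
    by real_asymp
  then have "eventually (\<lambda>u::real. (u / ln u ^ 3 * ln (1 + u / ln 2) + ln 2 / ln (u / ln u ^ 3) * u
      + r * ln (1 + u)) / (u / ln u) < ln 2 + \<epsilon>) at_top"
    using assms by (intro order_tendstoD) auto
  moreover have "eventually (\<lambda>u::real. 0 < u / ln u) at_top" by real_asymp
  ultimately show ?thesis
  proof eventually_elim
    case (elim u)
    then have "u / ln u ^ 3 * ln (1 + u / ln 2) + ln 2 / ln (u / ln u ^ 3) * u + r * ln (1 + u)
        < (ln 2 + \<epsilon>) * (u / ln u)"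
      by (simp only: pos_divide_less_eq)
    then show ?case by (simp only: times_divide_eq_right less_imp_le)
  qed
qed

text \<open>For large \<open>X\<close> the parameter \<open>y\<close> is chosen from \<open>X\<close> and not from \<open>n\<close>, which makes the bound uniform in
  \<open>n \<le> X\<close>; for bounded \<open>X\<close> the left-hand side is bounded and the exponential is at least \<open>1\<close>.\<close>

lemma divisor_bound:
  fixes \<epsilon> :: real and k :: nat
  assumes \<epsilon>: "\<epsilon> > 0"
  obtains C :: real where "C > 0"
    and "\<And>X n. 3 \<le> X \<Longrightarrow> 0 < n \<Longrightarrow> real n \<le> X \<Longrightarrow>
      real (card {d. d dvd n}) * (1 + ln X) ^ k \<le> C * exp ((ln 2 + \<epsilon>) * ln X / ln (ln X))"
proof -
  have "eventually (\<lambda>u::real. 1 < u / ln u ^ 3) at_top" by real_asymp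
  then have "eventually (\<lambda>u. u > 0 \<and> 1 < u / ln u ^ 3 \<and>
      u / ln u ^ 3 * ln (1 + u / ln 2) + ln 2 / ln (u / ln u ^ 3) * u + real k * ln (1 + u)
        \<le> (ln 2 + \<epsilon>) * u / ln u) at_top"
    using divisor_exponent_eventually[OF \<epsilon>, of "real k"] eventually_gt_at_top[of 0]
    by eventually_elim auto
  then obtain U where U: "\<And>u. U \<le> u \<Longrightarrow> u > 0 \<and> 1 < u / ln u ^ 3 \<and>
      u / ln u ^ 3 * ln (1 + u / ln 2) + ln 2 / ln (u / ln u ^ 3) * u + real k * ln (1 + u)
        \<le> (ln 2 + \<epsilon>) * u / ln u"
    unfolding eventually_at_top_linorder by blast
  define C where "C = 1 + exp U * (1 + \<bar>U\<bar>) ^ k"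
  have C: "1 \<le> C" by (simp add: C_def)
  show ?thesis
  proof (rule that[of C])
    show "C > 0" using C by simp
    fix X :: real and n :: nat
    assume X: "3 \<le> X" and n: "0 < n" "real n \<le> X"
    have "exp 1 < X" using exp_le X e_less_272 by linarith
    then have "ln (exp 1) < ln X" using X by (subst ln_less_cancel_iff) auto
    then have lnX: "1 < ln X" by simp
    show "real (card {d. d dvd n}) * (1 + ln X) ^ k \<le> C * exp ((ln 2 + \<epsilon>) * ln X / ln (ln X))"
    proof (cases "U \<le> ln X")
      case True
      define u where "u = ln X"
      define y where "y = u / ln u ^ 3"
      have u: "u > 0" "1 < y"
        "y * ln (1 + u / ln 2) + ln 2 / ln y * u + real k * ln (1 + u) \<le> (ln 2 + \<epsilon>) * u / ln u"
        using U[of u] True by (auto simp: u_def y_def)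
      have "real (card {d. d dvd n}) \<le> (1 + ln (real n) / ln 2) powr y * real n powr (ln 2 / ln y)"
        by (rule card_divisors_le[OF n(1) u(2)])
      also have "\<dots> \<le> (1 + u / ln 2) powr y * X powr (ln 2 / ln y)"
        using n u X by (intro mult_mono powr_mono2) (auto simp: u_def divide_right_mono)
      finally have "real (card {d. d dvd n}) * (1 + u) ^ k
          \<le> (1 + u / ln 2) powr y * X powr (ln 2 / ln y) * (1 + u) ^ k"
        using u by (intro mult_right_mono) auto
      also have "\<dots> = exp (y * ln (1 + u / ln 2) + ln 2 / ln y * u + real k * ln (1 + u))"
      proof -
        have "1 + u / ln 2 \<noteq> 0" using u(1) by (smt (verit) divide_pos_pos ln_gt_zero)
        moreover have "(1 + u) ^ k = exp (real k * ln (1 + u))"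
          using u(1) by (simp add: exp_of_nat_mult)
        ultimately show ?thesis using X by (simp add: powr_def exp_add u_def)
      qed
      also have "\<dots> \<le> 1 * exp ((ln 2 + \<epsilon>) * u / ln u)" using u(3) by simp
      also have "\<dots> \<le> C * exp ((ln 2 + \<epsilon>) * u / ln u)" using C by (intro mult_right_mono) auto
      finally show ?thesis by (simp add: u_def)
    next
      case False
      have "X \<le> exp U" using False X by (metis exp_ln_iff exp_le_cancel_iff less_le_trans linear zero_less_numeral)
      moreover have "card {d. d dvd n} \<le> card {1..n}"
        using n by (intro card_mono) (auto dest: dvd_imp_le intro: Suc_leI dvd_pos_nat)
      ultimately have "real (card {d. d dvd n}) \<le> exp U" using n by simp
      then have "real (card {d. d dvd n}) * (1 + ln X) ^ k \<le> exp U * (1 + \<bar>U\<bar>) ^ k"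
        using False lnX by (intro mult_mono power_mono) auto
      also have "\<dots> \<le> C * 1" by (simp add: C_def)
      also have "\<dots> \<le> C * exp ((ln 2 + \<epsilon>) * ln X / ln (ln X))"
        using C lnX \<epsilon> by (intro mult_left_mono) (auto intro!: divide_nonneg_nonneg mult_nonneg_nonneg add_nonneg_nonneg)
      finally show ?thesis .
    qed
  qed
qed

section \<open>Points close to a parabola\<close>

text \<open>Counting from \<open>x = 0\<close> instead of \<open>x = 1\<close> turns the parabola into another quadratic polynomial with
  the same leading coefficient.\<close>

lemma A_count_eq_card:
  fixes \<alpha> \<beta> \<gamma> a b \<delta> :: real
  assumes "b > 0"
  defines "f \<equiv> \<lambda>x::nat. \<alpha> / a * (real x)\<^sup>2 + (2 * \<alpha> / a + \<beta>) * real x + (\<alpha> / a + \<beta> + \<gamma> * a)"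
  shows "A_count \<alpha> \<beta> \<gamma> a b \<delta> = card {x. x < nat \<lfloor>b\<rfloor> \<and> dist_nearest_int (f x) < \<delta>}"
proof -
  have f: "f x = \<alpha> * (real_of_int (int x + 1))\<^sup>2 / a + \<beta> * real_of_int (int x + 1) + \<gamma> * a" for x
    by (simp add: f_def power2_eq_square algebra_simps add_divide_distrib)
  have "bij_betw (\<lambda>x. int x + 1) {x. x < nat \<lfloor>b\<rfloor> \<and> dist_nearest_int (f x) < \<delta>} (near_points \<alpha> \<beta> \<gamma> a b \<delta>)"
  proof (rule bij_betw_byWitness[where f' = "\<lambda>z. nat (z - 1)"])
    show "(\<lambda>x. int x + 1) ` {x. x < nat \<lfloor>b\<rfloor> \<and> dist_nearest_int (f x) < \<delta>} \<subseteq> near_points \<alpha> \<beta> \<gamma> a b \<delta>"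
    proof
      fix z assume "z \<in> (\<lambda>x. int x + 1) ` {x. x < nat \<lfloor>b\<rfloor> \<and> dist_nearest_int (f x) < \<delta>}"
      then obtain x where x: "z = int x + 1" "x < nat \<lfloor>b\<rfloor>" "dist_nearest_int (f x) < \<delta>" by blast
      have "z \<le> \<lfloor>b\<rfloor>" using x by linarith
      then show "z \<in> near_points \<alpha> \<beta> \<gamma> a b \<delta>"
        using x(3) unfolding near_points_def f x(1) by (simp add: le_floor_iff)
    qed
    show "(\<lambda>z. nat (z - 1)) ` near_points \<alpha> \<beta> \<gamma> a b \<delta> \<subseteq> {x. x < nat \<lfloor>b\<rfloor> \<and> dist_nearest_int (f x) < \<delta>}"
    proof
      fix x assume "x \<in> (\<lambda>z. nat (z - 1)) ` near_points \<alpha> \<beta> \<gamma> a b \<delta>"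
      then obtain z where z: "x = nat (z - 1)" "z \<in> near_points \<alpha> \<beta> \<gamma> a b \<delta>" by blast
      then have zx: "z = int x + 1" and "z \<le> \<lfloor>b\<rfloor>" by (auto simp: near_points_def le_floor_iff)
      then have "x < nat \<lfloor>b\<rfloor>" by linarith
      then show "x \<in> {x. x < nat \<lfloor>b\<rfloor> \<and> dist_nearest_int (f x) < \<delta>}"
        using z(2) unfolding near_points_def f zx by simp
    qed
  qed (auto simp: near_points_def)
  then show ?thesis by (simp add: A_count_def bij_betw_same_card)
qed

lemma abs_E_error_le_trivial:
  assumes "b > 0" "0 < \<delta>" "\<delta> < 1/2"
  shows "\<bar>E_error \<alpha> \<beta> \<gamma> a b \<delta>\<bar> \<le> b"
proof -
  have "card (near_points \<alpha> \<beta> \<gamma> a b \<delta>) \<le> card {1..\<lfloor>b\<rfloor>}"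
    by (intro card_mono) (auto simp: near_points_def le_floor_iff)
  then have "real (A_count \<alpha> \<beta> \<gamma> a b \<delta>) \<le> real (nat \<lfloor>b\<rfloor>)" by (simp add: A_count_def)
  also have "\<dots> \<le> b" using assms(1) by (simp add: of_nat_nat)
  finally have "real (A_count \<alpha> \<beta> \<gamma> a b \<delta>) \<le> b" .
  moreover have "0 \<le> 2 * \<delta> * b" "2 * \<delta> * b \<le> 1 * b" using assms by (auto intro!: mult_right_mono)
  ultimately show ?thesis unfolding E_error_def by linarith
qed

lemma exp_sum_mean_squared_le:
  "(\<Sum>m=1..<K. norm (exp_sum f B (int m)) / real m)\<^sup>2
    \<le> harm K * (\<Sum>m=1..<K. (norm (exp_sum f B (int m)))\<^sup>2 / real m)"
proof -
  let ?S = "\<lambda>m. norm (exp_sum f B (int m))"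
  have "(\<Sum>m=1..<K. ?S m / real m) = (\<Sum>m=1..<K. (1 / sqrt (real m)) * (?S m / sqrt (real m)))"
    by (intro sum.cong) (auto simp flip: real_sqrt_mult)
  also have "(\<dots>)\<^sup>2 \<le> (\<Sum>m=1..<K. (1 / sqrt (real m))\<^sup>2) * (\<Sum>m=1..<K. (?S m / sqrt (real m))\<^sup>2)"
    by (rule Cauchy_Schwarz_ineq_sum)
  also have "(\<Sum>m=1..<K. (1 / sqrt (real m))\<^sup>2) = (\<Sum>m=1..<K. inverse (real m))"
    by (intro sum.cong) (auto simp: power_divide inverse_eq_divide)
  also have "(\<Sum>m=1..<K. (?S m / sqrt (real m))\<^sup>2) = (\<Sum>m=1..<K. (?S m)\<^sup>2 / real m)"
    by (intro sum.cong) (auto simp: power_divide)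
  also have "(\<Sum>m=1..<K. inverse (real m)) * (\<Sum>m=1..<K. (?S m)\<^sup>2 / real m)
      \<le> harm K * (\<Sum>m=1..<K. (?S m)\<^sup>2 / real m)"
    unfolding harm_def by (intro mult_right_mono sum_mono2 sum_nonneg) auto
  finally show ?thesis .
qed

lemma harm_nat_floor_le:
  fixes c x :: real
  assumes c: "c > 0" and x: "1 \<le> x"
  shows "harm (nat \<lfloor>x / c\<rfloor>) \<le> 1 + ln x + \<bar>ln c\<bar>"
proof (cases "nat \<lfloor>x / c\<rfloor> = 0")
  case True
  moreover have "0 \<le> ln x" using x by simp
  ultimately show ?thesis by (simp add: harm_expand)
next
  case False
  then have pos: "0 < nat \<lfloor>x / c\<rfloor>" by simp
  have "real (nat \<lfloor>x / c\<rfloor>) \<le> x / c" using x c by simp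
  then have "ln (real (nat \<lfloor>x / c\<rfloor>)) \<le> ln (x / c)"
    using pos x c by (subst ln_le_cancel_iff) auto
  also have "\<dots> \<le> ln x + \<bar>ln c\<bar>" using x c by (simp add: ln_div)
  finally show ?thesis using harm_le_ln[OF pos] by linarith
qed

text \<open>For \<open>\<tau> = 2 \<bar>\<alpha>\<bar> / a\<close> the two factors in the block sum are, up to constants and a logarithm,
  \<open>b / a + 1\<close> and \<open>a + b\<close>, whose product is exactly the square of \<open>W = \<surd>a + b / \<surd>a\<close>.\<close>

lemma parabola_mean_square:
  fixes a b \<alpha> \<beta> c D L :: real
  assumes \<alpha>: "\<alpha> \<noteq> 0" and a: "a > 1" and b: "b > 1"
    and L: "1 \<le> L" "ln a \<le> 2 * L" "harm K \<le> L" and D: "1 \<le> D"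
    and divisors: "\<And>n. 0 < n \<Longrightarrow> n < K * nat \<lfloor>b\<rfloor> \<Longrightarrow> real (card {d. d dvd n}) \<le> D"
  defines "f \<equiv> \<lambda>x::nat. \<alpha> / a * (real x)\<^sup>2 + \<beta> * real x + c"
    and "W \<equiv> sqrt a + b / sqrt a"
  shows "(\<Sum>m=1..<K. (norm (exp_sum f (nat \<lfloor>b\<rfloor>) (int m)))\<^sup>2 / real m)
    \<le> (1 + 2 * ((2 * \<bar>\<alpha>\<bar> + 2) * (4 + 1 / \<bar>\<alpha>\<bar>) * (3 + \<bar>ln (4 * \<bar>\<alpha>\<bar>)\<bar>))) * W\<^sup>2 * D * L\<^sup>2"
proof -
  define B where "B = nat \<lfloor>b\<rfloor>"
  define c0 where "c0 = \<bar>ln (4 * \<bar>\<alpha>\<bar>)\<bar>"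
  define c2 where "c2 = (2 * \<bar>\<alpha>\<bar> + 2) * (4 + 1 / \<bar>\<alpha>\<bar>) * (3 + c0)"
  define \<tau> where "\<tau> = 2 * \<bar>\<alpha> / a\<bar>"
  have c0: "0 \<le> c0" by (simp add: c0_def)
  have c2: "0 \<le> c2" using c0 by (simp add: c2_def)
  have \<tau>: "\<tau> = 2 * \<bar>\<alpha>\<bar> / a" "1 / (2 * \<tau>) = a / (4 * \<bar>\<alpha>\<bar>)" "2 / \<tau> = a / \<bar>\<alpha>\<bar>"
    using a \<alpha> by (auto simp: \<tau>_def field_simps)
  have B: "0 < B" "real B \<le> b" using b unfolding B_def by linarith+
  have W2: "W\<^sup>2 = (b / a + 1) * (a + b)"
  proof -
    have "W\<^sup>2 = (sqrt a)\<^sup>2 + 2 * (sqrt a * (b / sqrt a)) + b\<^sup>2 / (sqrt a)\<^sup>2"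
      by (simp add: W_def power2_sum power_divide)
    also have "\<dots> = a + 2 * b + b\<^sup>2 / a" using a by simp
    finally show ?thesis using a by (simp add: field_simps power2_eq_square)
  qed
  have b_le: "b \<le> W\<^sup>2"
  proof -
    have "1 * b \<le> (b / a + 1) * (a + b)" using a b by (intro mult_mono) auto
    then show ?thesis by (simp add: W2)
  qed
  have H: "harm (nat \<lfloor>1 / (2 * \<tau>)\<rfloor>) \<le> (3 + c0) * L"
  proof -
    have "harm (nat \<lfloor>a / (4 * \<bar>\<alpha>\<bar>)\<rfloor>) \<le> 1 + ln a + c0"
      unfolding c0_def using \<alpha> a by (intro harm_nat_floor_le) auto
    also have "\<dots> \<le> 1 * L + 2 * L + c0 * L"
      using L c0 mult_left_mono[OF L(1) c0] by linarith
    finally show ?thesis unfolding \<tau> by (simp add: algebra_simps)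
  qed
  have block: "(real B * \<tau> + 2) * (4 * real B + 2 / \<tau> * harm (nat \<lfloor>1 / (2 * \<tau>)\<rfloor>)) \<le> c2 * W\<^sup>2 * L"
  proof -
    have "real B * \<tau> + 2 \<le> (2 * \<bar>\<alpha>\<bar> + 2) * (b / a + 1)"
    proof -
      have "real B * \<tau> \<le> b * \<tau>" using B by (intro mult_right_mono) (simp_all add: \<tau>_def)
      also have "b * \<tau> = 2 * \<bar>\<alpha>\<bar> * (b / a)" by (simp add: \<tau>)
      finally have "real B * \<tau> + 2 \<le> 2 * \<bar>\<alpha>\<bar> * (b / a) + 2" by simp
      moreover have "0 \<le> b / a" using a b by simp
      moreover have "p * q + 2 \<le> (p + 2) * (q + 1)" if "0 \<le> p" "0 \<le> q" for p q :: real
        using that by (simp add: algebra_simps)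
      from this[of "2 * \<bar>\<alpha>\<bar>" "b / a"] \<open>0 \<le> b / a\<close>
      have "2 * \<bar>\<alpha>\<bar> * (b / a) + 2 \<le> (2 * \<bar>\<alpha>\<bar> + 2) * (b / a + 1)" by simp
      ultimately show ?thesis by linarith
    qed
    moreover have "4 * real B + 2 / \<tau> * harm (nat \<lfloor>1 / (2 * \<tau>)\<rfloor>) \<le> (4 + 1 / \<bar>\<alpha>\<bar>) * (a + b) * ((3 + c0) * L)"
    proof -
      have one: "1 \<le> (3 + c0) * L" using L c0 mult_mono[of 1 "3 + c0" 1 L] by simp
      have "4 * real B \<le> 4 * (a + b) * ((3 + c0) * L)"
        using B a one mult_mono[of "4 * real B" "4 * (a + b)" 1 "(3 + c0) * L"] by simp
      moreover have "2 / \<tau> * harm (nat \<lfloor>1 / (2 * \<tau>)\<rfloor>) \<le> 1 / \<bar>\<alpha>\<bar> * (a + b) * ((3 + c0) * L)"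
        unfolding \<tau>(3) using a b \<alpha> H
        by (intro mult_mono) (auto simp: divide_right_mono harm_nonneg)
      ultimately show ?thesis by (simp add: distrib_right)
    qed
    ultimately have "(real B * \<tau> + 2) * (4 * real B + 2 / \<tau> * harm (nat \<lfloor>1 / (2 * \<tau>)\<rfloor>))
        \<le> ((2 * \<bar>\<alpha>\<bar> + 2) * (b / a + 1)) * ((4 + 1 / \<bar>\<alpha>\<bar>) * (a + b) * ((3 + c0) * L))"
      using a b by (intro mult_mono) (auto simp: \<tau> harm_nonneg)
    also have "\<dots> = c2 * W\<^sup>2 * L" unfolding W2 c2_def by (simp only: mult_ac)
    finally show ?thesis .
  qed
  have "(\<Sum>m=1..<K. (norm (exp_sum f B (int m)))\<^sup>2 / real m)
      \<le> harm K * (real B + 2 * D * ((real B * \<tau> + 2) * (4 * real B + 2 / \<tau> * harm (nat \<lfloor>1 / (2 * \<tau>)\<rfloor>))))"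
    unfolding f_def \<tau>_def using \<alpha> a B(1) D divisors
    by (intro weighted_weyl_mean_square) (auto simp: B_def)
  also have "\<dots> \<le> L * (W\<^sup>2 * D * L + 2 * D * (c2 * W\<^sup>2 * L))"
  proof (rule mult_mono[OF L(3)])
    have "W\<^sup>2 * 1 * 1 \<le> W\<^sup>2 * D * L" using D L by (intro mult_mono) auto
    then have "real B \<le> W\<^sup>2 * D * L" using B b_le by linarith
    then show "real B + 2 * D * ((real B * \<tau> + 2) * (4 * real B + 2 / \<tau> * harm (nat \<lfloor>1 / (2 * \<tau>)\<rfloor>)))
        \<le> W\<^sup>2 * D * L + 2 * D * (c2 * W\<^sup>2 * L)"
      using block D by (intro add_mono mult_left_mono) auto
  qed (use D L in \<open>auto simp: \<tau>_def harm_nonneg\<close>)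
  also have "\<dots> = (1 + 2 * c2) * W\<^sup>2 * D * L\<^sup>2"
    by (simp add: power2_eq_square algebra_simps)
  finally show ?thesis by (simp only: c2_def c0_def B_def)
qed

theorem theorem2:
  fixes \<alpha> \<beta> \<gamma> \<epsilon> :: real
  assumes "\<alpha> \<noteq> 0" and "\<epsilon> > 0"
  shows "\<exists>C::real. C > 0 \<and>
    (\<forall>(a::real) (b::real) (\<delta>::real). a > 1 \<longrightarrow> b > 1 \<longrightarrow> 0 < \<delta> \<longrightarrow> \<delta> < 1/2 \<longrightarrow>
      \<bar>E_error \<alpha> \<beta> \<gamma> a b \<delta>\<bar> \<le>
        C * (a powr (1/2) + b * a powr (-1/2)) *
        exp ((1/2 * ln 2 + \<epsilon>) * ln (Delta a b) / ln (ln (Delta a b))))"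
proof -
  \<comment> \<open>The proof loses a factor \<open>L \<surd>L\<^sup>3\<close> with \<open>L = 1 + ln X\<close>, and the divisor bound enters under a square
    root: \<open>L\<^sup>5\<close> is the square of that factor, and \<open>ln 2 + 2 \<epsilon>\<close> is twice the required constant.\<close>
  obtain C1 where C1: "C1 > 0" and divisors: "\<And>X n. 3 \<le> X \<Longrightarrow> 0 < n \<Longrightarrow> real n \<le> X \<Longrightarrow>
      real (card {d. d dvd n}) * (1 + ln X) ^ 5 \<le> C1 * exp ((ln 2 + 2 * \<epsilon>) * ln X / ln (ln X))"
    using divisor_bound[of "2 * \<epsilon>" 5] assms(2) by auto
  define c3 where "c3 = 1 + 2 * ((2 * \<bar>\<alpha>\<bar> + 2) * (4 + 1 / \<bar>\<alpha>\<bar>) * (3 + \<bar>ln (4 * \<bar>\<alpha>\<bar>)\<bar>))"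
  have c3: "0 \<le> c3" by (simp add: c3_def)
  define C where "C = 386 * (2 * sqrt C1 + sqrt (c3 * C1)) + 1"
  have C: "1 \<le> C" using C1 c3 by (simp add: C_def)
  have "\<bar>E_error \<alpha> \<beta> \<gamma> a b \<delta>\<bar> \<le> C * (a powr (1/2) + b * a powr (-1/2)) *
        exp ((1/2 * ln 2 + \<epsilon>) * ln (Delta a b) / ln (ln (Delta a b)))"
    if a: "a > 1" and b: "b > 1" and \<delta>: "0 < \<delta>" "\<delta> < 1/2" for a b \<delta> :: real
  proof -
    define X where "X = Delta a b"
    define L where "L = 1 + ln X"
    define F where "F = exp ((1/2 * ln 2 + \<epsilon>) * ln X / ln (ln X))"
    define W where "W = sqrt a + b / sqrt a"
    \<comment> \<open>The cut-off frequency for which the resolution error \<open>b / K0\<close> is equal to \<open>W\<close>.  All products of a frequency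
      below \<open>K0\<close> and a shift below \<open>b\<close> are then at most \<open>b * K0 \<le> X\<close>.\<close>
    define K0 where "K0 = b * sqrt a / (a + b)"
    have X: "3 \<le> X" "b * K0 \<le> X"
      using a by (auto simp: X_def Delta_def K0_def powr_half_sqrt power2_eq_square mult_ac)
    have "exp 1 < X" using X e_less_272 by linarith
    then have "ln (exp 1) < ln X" using X by (subst ln_less_cancel_iff) auto
    then have lnX: "1 < ln X" by simp
    then have L: "1 \<le> L" by (simp add: L_def)
    have F: "1 \<le> F"
      using lnX assms(2) by (auto simp: F_def intro!: divide_nonneg_nonneg mult_nonneg_nonneg add_nonneg_nonneg)
    have F2: "exp ((ln 2 + 2 * \<epsilon>) * ln X / ln (ln X)) = F\<^sup>2"
      unfolding F_def exp_double[symmetric] by (simp add: algebra_simps add_divide_distrib)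
    have W_eq: "a powr (1/2) + b * a powr (-1/2) = W"
      using a by (simp add: W_def powr_half_sqrt powr_minus_divide)
    have "1 \<le> sqrt a" "0 \<le> b / sqrt a" using a b by auto
    then have W: "1 \<le> W" unfolding W_def by linarith
    have W_frac: "W = (a + b) / sqrt a" using a by (simp add: W_def add_divide_distrib real_div_sqrt)
    have WF: "W \<le> W * F" "0 \<le> W * F" using W F by auto
    have "\<bar>E_error \<alpha> \<beta> \<gamma> a b \<delta>\<bar> \<le> C * (W * F)"
    proof (cases "K0 < 1")
      case True
      \<comment> \<open>No frequency is available, but then the trivial bound \<open>b\<close> suffices.\<close>
      then have "b < W" using a b by (simp add: K0_def W_frac field_simps)
      moreover have "\<bar>E_error \<alpha> \<beta> \<gamma> a b \<delta>\<bar> \<le> b"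
        using b \<delta> by (intro abs_E_error_le_trivial) auto
      moreover have "1 * (W * F) \<le> C * (W * F)" using C WF by (intro mult_right_mono) auto
      ultimately show ?thesis using WF by linarith
    next
      case False
      define K where "K = nat \<lfloor>K0\<rfloor>"
      define B where "B = nat \<lfloor>b\<rfloor>"
      define f where "f = (\<lambda>x::nat. \<alpha> / a * (real x)\<^sup>2 + (2 * \<alpha> / a + \<beta>) * real x + (\<alpha> / a + \<beta> + \<gamma> * a))"
      define D where "D = C1 * F\<^sup>2 / L ^ 5"
      have "1 \<le> \<lfloor>K0\<rfloor>" using False by simp
      then have "0 < K" "real K = of_int \<lfloor>K0\<rfloor>" "1 \<le> real K" unfolding K_def by auto
      then have K: "0 < K" "real K \<le> K0" "K0 / 2 \<le> real K" by linarith+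
      have B: "0 < B" "real B \<le> b" "b - real B \<le> 1" using b unfolding B_def by linarith+
      have KB: "real (K * B) \<le> X"
      proof -
        have "real K * real B \<le> K0 * b" using K B False by (intro mult_mono) auto
        then show ?thesis using X by (simp add: mult.commute)
      qed
      have D_bound: "real (card {d. d dvd n}) \<le> D" if "0 < n" "real n \<le> X" for n
        using divisors[OF X(1) that] L unfolding F2 D_def L_def[symmetric] by (simp add: field_simps)
      have D: "1 \<le> D" using D_bound[of 1] X by simp
      have "real K * 1 \<le> real K * real B" using B by (intro mult_left_mono) auto
      then have "real K \<le> X" using KB by simp
      then have "ln (real K) \<le> ln X" using K X by (subst ln_le_cancel_iff) auto
      then have harmK: "harm K \<le> L" "harm (2 * K) \<le> 2 * L"
        using harm_le_ln[of K] harm_le_ln[of "2 * K"] K L ln_add_one_self_le_self[of 1]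
        by (auto simp: L_def ln_mult)
      \<comment> \<open>The logarithm of \<open>a\<close> comes from the block sums; \<open>K0 \<ge> 1\<close> keeps \<open>a\<close> below \<open>X\<^sup>2\<close>.\<close>
      have lna: "ln a \<le> 2 * L"
      proof -
        have "a + b \<le> b * sqrt a" using False a b by (simp add: K0_def field_simps)
        then have "sqrt a * sqrt a \<le> b * sqrt a" using a b by simp
        then have "sqrt a \<le> b" using a by (subst (asm) mult_le_cancel_right_pos) auto
        also have "b \<le> b * K0" using False b by simp
        finally have "sqrt a \<le> X" using X by linarith
        then have "ln (sqrt a) \<le> ln X" using a X by (subst ln_le_cancel_iff) auto
        then show ?thesis using a by (simp add: ln_sqrt L_def)
      qed
      let ?T = "\<Sum>m=1..<K. norm (exp_sum f B (int m)) / real m"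
      have "?T\<^sup>2 \<le> harm K * (\<Sum>m=1..<K. (norm (exp_sum f B (int m)))\<^sup>2 / real m)"
        by (rule exp_sum_mean_squared_le)
      also have "\<dots> \<le> L * (c3 * W\<^sup>2 * D * L\<^sup>2)"
      proof (rule mult_mono[OF harmK(1)])
        show "(\<Sum>m=1..<K. (norm (exp_sum f B (int m)))\<^sup>2 / real m) \<le> c3 * W\<^sup>2 * D * L\<^sup>2"
          unfolding c3_def W_def f_def B_def
        proof (rule parabola_mean_square[OF assms(1) a b L lna harmK(1) D])
          fix n :: nat assume n: "0 < n" "n < K * nat \<lfloor>b\<rfloor>"
          then have "real n \<le> real (K * B)" by (simp only: B_def of_nat_le_iff)
          then show "real (card {d. d dvd n}) \<le> D" using KB n by (intro D_bound) auto
        qed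
      qed (use L in \<open>auto intro!: sum_nonneg\<close>)
      also have "\<dots> = (sqrt (c3 * C1) * (W * F) / L)\<^sup>2"
        using L C1 c3 by (simp add: D_def power_mult_distrib power_divide field_simps power2_eq_square eval_nat_numeral)
      finally have "?T \<le> sqrt (c3 * C1) * (W * F) / L"
        by (rule power2_le_imp_le) (use L WF C1 c3 in auto)
      then have T: "L * ?T \<le> sqrt (c3 * C1) * (W * F)"
        using L by (simp add: field_simps)
      have BK: "real B / real K \<le> 2 * W"
      proof -
        have "real B / real K \<le> b / (K0 / 2)" using K B False by (intro frac_le) auto
        also have "\<dots> = 2 * W" using a b by (simp add: K0_def W_frac field_simps)
        finally show ?thesis .
      qed
      have LF: "L \<le> sqrt C1 * F"
      proof (rule power2_le_imp_le)
        have "L ^ 2 \<le> L ^ 5" using L by (intro power_increasing) auto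
        also have "\<dots> \<le> C1 * F\<^sup>2" using divisors[of X 1] X unfolding F2 L_def[symmetric] by simp
        finally show "L\<^sup>2 \<le> (sqrt C1 * F)\<^sup>2" using C1 by (simp add: power_mult_distrib)
      qed (use C1 F in auto)
      have "\<bar>real (A_count \<alpha> \<beta> \<gamma> a b \<delta>) - 2 * \<delta> * real B\<bar> \<le> 193 * harm (2 * K) * et_bound f B K"
        using erdos_turan_count[OF K(1) \<delta>, of B f] A_count_eq_card[of b \<alpha> \<beta> \<gamma> a \<delta>] b
        by (simp add: f_def B_def)
      also have "\<dots> \<le> 193 * (2 * L) * et_bound f B K"
        by (intro mult_right_mono mult_left_mono harmK et_bound_nonneg) auto
      also have "\<dots> = 386 * (L * (real B / real K) + L * ?T)"
        by (simp only: et_bound_def distrib_left)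
      also have "\<dots> \<le> 386 * (2 * sqrt C1 * (W * F) + sqrt (c3 * C1) * (W * F))"
      proof (intro mult_left_mono add_mono T)
        have "L * (real B / real K) \<le> (sqrt C1 * F) * (2 * W)"
          using L LF BK W by (intro mult_mono) auto
        then show "L * (real B / real K) \<le> 2 * sqrt C1 * (W * F)" by (simp only: mult_ac)
      qed simp
      finally have main: "\<bar>real (A_count \<alpha> \<beta> \<gamma> a b \<delta>) - 2 * \<delta> * real B\<bar>
          \<le> 386 * (2 * sqrt C1 * (W * F) + sqrt (c3 * C1) * (W * F))" .
      have "0 \<le> 2 * \<delta> * (b - real B)" using \<delta> B by simp
      moreover have "(2 * \<delta>) * (b - real B) \<le> 1 * 1"
        using \<delta> B by (intro mult_mono) auto
      ultimately have "\<bar>2 * \<delta> * real B - 2 * \<delta> * b\<bar> \<le> 1" by (simp add: algebra_simps)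
      with main have "\<bar>E_error \<alpha> \<beta> \<gamma> a b \<delta>\<bar>
          \<le> 386 * (2 * sqrt C1 * (W * F) + sqrt (c3 * C1) * (W * F)) + 1"
        unfolding E_error_def by linarith
      also have "\<dots> \<le> 386 * (2 * sqrt C1 * (W * F) + sqrt (c3 * C1) * (W * F)) + 1 * (W * F)"
        using W WF by linarith
      also have "\<dots> = C * (W * F)" by (simp only: C_def distrib_right mult.assoc)
      finally show ?thesis .
    qed
    then show ?thesis unfolding W_eq by (simp only: F_def X_def mult.assoc)
  qed
  with C show ?thesis by (intro exI[of _ C]) auto
qed

end
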